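(* Let $\mathbb F_q$ be a finite field of odd characteristic and let $d\in\mathbb F_q[x]$ be square-free of degree $D\ge3$. Then for every $t\in\mathbb R$, $$\big|L(\tfrac12+it,\chi_d)\big|<4\,|d|^{\frac{10}{\log D}}.$$
   Context: $|d|=q^{\deg d}$. $\chi_d(m)=(d/m)$ is the Kronecker symbol for monic $m$ (completely multiplicative in $m$, $(d/1)=1$, and for $p$ monic irreducible $(d/p)=0$ if $p\mid d$, else $\pm1$ according as $d$ is a square mod $p$), and $L(s,\chi_d)=\sum_{m\ \text{monic}}\chi_d(m)|m|^{-s}$, which for such $d$ is a polynomial in $q^{-s}$ (hence entire). *)

theory Defs
  imports "HOL-Analysis.Analysis" "HOL-Computational_Algebra.Computational_Algebra"
begin

definition poly_legendre :: "'a::{field_gcd,finite} poly \<Rightarrow> 'a poly \<Rightarrow> int" where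
  "poly_legendre d p =
     (if p dvd d then 0
      else if (\<exists>y. p dvd (y ^ 2 - d)) then 1 else -1)"

definition kronecker_poly :: "'a::{field_gcd,finite} poly \<Rightarrow> 'a poly \<Rightarrow> int" where
  "kronecker_poly d m =
     (\<Prod>p\<in>prime_factors m. poly_legendre d p ^ multiplicity p m)"

definition monic_of_degree :: "nat \<Rightarrow> 'a::{field_gcd,finite} poly set" where
  "monic_of_degree n = {m. lead_coeff m = 1 \<and> degree m = n}"

definition poly_abs :: "'a::{field_gcd,finite} poly \<Rightarrow> real" where
  "poly_abs m = real CARD('a) ^ degree m"

text \<open>L(s,chi_d) = sum over monic m of chi_d(m) |m|^(-s), summed by degree
  (the standard ordering of the Dirichlet series over F_q[x]).\<close>
definition L_chi :: "'a::{field_gcd,finite} poly \<Rightarrow> complex \<Rightarrow> complex" where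
  "L_chi d s = (\<Sum>n. \<Sum>m\<in>monic_of_degree n.
       of_int (kronecker_poly d m) * complex_of_real (poly_abs m) powr (- s))"

end

theory Submission
  imports "HOL-Algebra.Algebraic_Closure_Type" "HOL-Complex_Analysis.Complex_Analysis" Defs
begin

text \<open>
  By reciprocity \<open>L\<close> is a polynomial of degree less than \<open>D\<close> in \<open>u = q^(-s)\<close>, say
  \<open>\<Prod> (1 - \<alpha> u)\<close>, and the Euler product identifies \<open>- \<Sum> \<alpha>^j\<close> with the character sum of \<open>d\<close> over
  the field with \<open>q^j\<close> elements. Stepanov's method, in the form given to it by Bombieri, bounds these
  sums by a constant times \<open>q^(j/2)\<close> for even \<open>j\<close>, hence \<open>|\<alpha>| \<le> sqrt q\<close>. On the critical line
  \<open>z = \<alpha> u\<close> then lies in the unit disc, where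
  \<open>ln |1 - z| \<le> 1/N - Re (\<Sum> c(n) z^n)\<close> for some \<open>0 \<le> c(n) \<le> 1/n\<close>, \<open>1 \<le> n < N\<close>. Summing over the
  \<open>\<alpha>\<close>, estimating the power sums trivially by \<open>q^(n/2)\<close>, and taking \<open>N\<close> about \<open>2 ln D / ln q\<close>
  gives the bound.
\<close>

section \<open>Evaluation in the algebraic closure\<close>

text \<open>The bound for |\<alpha>| serves to keep z in the unit disc, where the majorant holds;
  the power sums are then estimated trivially. At this scale that costs only a constant: after
  scaling, the trivial bound q^(n/2) exceeds the bound D, which |z| \<le> 1 would give, only when
  q^(n/2) > D, that is beyond the cutoff. What remains is D/N plus a sum dominated by its last
  terms, both of order D ln q / ln D.

  Stepanov's method is run over a field whose size is a square R^2, because the large powers of Y in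
  the auxiliary polynomial are multiples of R and become cheap after raising to the power R. Even
  exponents are enough, since they control the squares \<alpha>^2. The method yields upper bounds
  only; applying it to both values of the character makes them two-sided.

  No finite extension is constructed: the field with q^j elements is the set of fixed points of the
  q^j-th power map in one algebraic closure, and residue symbols are read there as powers.
  Identities in the closure determine integers only modulo the characteristic, so they are lifted by
  the smallness of the integers involved.\<close>

lemma poly_to_ac_mult: "map_poly to_ac (p * r) = map_poly to_ac p * map_poly to_ac r"
  by (rule poly_eqI) (simp add: coeff_map_poly coeff_mult to_ac_sum)

definition ev :: "'a::field poly \<Rightarrow> 'a alg_closure \<Rightarrow> 'a alg_closure" where
  "ev p x = poly (map_poly to_ac p) x"

lemma ev_0 [simp]: "ev 0 x = 0"
  and ev_1 [simp]: "ev 1 x = 1"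
  by (simp_all add: ev_def map_poly_1)

lemma ev_add: "ev (p + r) x = ev p x + ev r x"
proof -
  have "map_poly to_ac (p + r) = map_poly to_ac p + map_poly to_ac r"
    by (rule poly_eqI) (simp add: coeff_map_poly)
  thus ?thesis by (simp add: ev_def)
qed

lemma ev_diff: "ev (p - r) x = ev p x - ev r x"
proof -
  have "map_poly to_ac (p - r) = map_poly to_ac p - map_poly to_ac r"
    by (rule poly_eqI) (simp add: coeff_map_poly)
  thus ?thesis by (simp add: ev_def)
qed

lemma ev_mult: "ev (p * r) x = ev p x * ev r x"
  by (simp add: ev_def poly_to_ac_mult)

lemma ev_power: "ev (p ^ n) x = ev p x ^ n"
  by (induction n) (simp_all add: ev_mult)

lemma ev_X [simp]: "ev [:0, 1:] x = x"
  by (simp add: ev_def map_poly_pCons)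

lemma ev_pCons: "ev (pCons a p) x = to_ac a + x * ev p x"
  by (simp add: ev_def map_poly_pCons)

lemma degree_map_to_ac [simp]: "degree (map_poly to_ac p) = degree p"
  by (rule degree_map_poly) auto

lemma map_to_ac_eq_0_iff [simp]: "map_poly to_ac p = 0 \<longleftrightarrow> p = 0"
  by (rule map_poly_eq_0_iff) auto

lemma ev_root_exists: "degree p > 0 \<Longrightarrow> \<exists>x. ev p x = 0"
  unfolding ev_def by (rule alg_closed_imp_poly_has_root) simp

lemma finite_ev_roots: "p \<noteq> 0 \<Longrightarrow> finite {x. ev p x = 0}"
  unfolding ev_def by (rule poly_roots_finite) simp

lemma card_ev_roots: "p \<noteq> 0 \<Longrightarrow> card {x. ev p x = 0} \<le> degree p"
  unfolding ev_def using card_poly_roots_bound[of "map_poly to_ac p"] by simp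

lemma ev_eq_0_mono: "p dvd r \<Longrightarrow> ev p x = 0 \<Longrightarrow> ev r x = 0"
  by (auto simp: dvd_def ev_mult)

lemma coprime_no_common_ev_root:
  fixes p r :: "'a::field_gcd poly"
  assumes "coprime p r" "ev p x = 0"
  shows "ev r x \<noteq> 0"
proof
  assume r: "ev r x = 0"
  obtain u v where "u * p + v * r = 1"
    using assms(1) by (metis bezout_coefficients_fst_snd coprime_imp_gcd_eq_1)
  hence "ev (u * p + v * r) x = 1" by simp
  thus False using assms r by (simp add: ev_add ev_mult)
qed

lemma irreducible_ev_root_dvd:
  fixes p r :: "'a::field_gcd poly"
  assumes "irreducible p" "ev p x = 0" "ev r x = 0"
  shows "p dvd r"
  using assms coprime_no_common_ev_root prime_elem_imp_coprime irreducible_imp_prime_elem by blast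

section \<open>Finite fields and the Frobenius map on the closure\<close>

lemma card_field_gt_1: "CARD('a::{field,finite}) > 1"
proof -
  have "card {0, 1 :: 'a} \<le> CARD('a)" by (intro card_mono) auto
  thus ?thesis by simp
qed

text \<open>Multiplication by \<open>a\<close> permutes \<open>G\<close>, so the product over
  \<open>G\<close> absorbs the factor \<open>a ^ card G\<close> and can be cancelled. Stated for
  subsets, it serves both the base field and the residue fields inside the closure.\<close>

lemma finite_mult_closed_power_eq_1:
  fixes G :: "'b::field set"
  assumes "finite G" "0 \<notin> G" "\<And>x y. x \<in> G \<Longrightarrow> y \<in> G \<Longrightarrow> x * y \<in> G" "a \<in> G"
  shows "a ^ card G = 1"
proof -
  have a0: "a \<noteq> 0" using assms by auto
  have inj: "inj_on ((*) a) G" using a0 by (auto simp: inj_on_def)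
  have "(*) a ` G = G"
    by (rule endo_inj_surj) (use assms inj in auto)
  hence "\<Prod>G = (\<Prod>x\<in>(*) a ` G. x)" by simp
  also have "\<dots> = (\<Prod>x\<in>G. a * x)" by (subst prod.reindex[OF inj]) simp
  also have "\<dots> = a ^ card G * \<Prod>G" by (simp add: prod.distrib)
  finally have "\<Prod>G = a ^ card G * \<Prod>G" .
  moreover have "\<Prod>G \<noteq> 0" using assms by (metis prod_zero_iff)
  ultimately show ?thesis by simp
qed

lemma finite_field_power_card: "(a :: 'a::{field,finite}) ^ CARD('a) = a"
proof (cases "a = 0")
  case False
  have "a ^ card (UNIV - {0::'a}) = 1"
    by (rule finite_mult_closed_power_eq_1) (use False in auto)
  hence "a ^ (CARD('a) - 1) = 1" by (simp add: card_Diff_singleton)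
  moreover have "CARD('a) = Suc (CARD('a) - 1)" using card_field_gt_1[where 'a='a] by simp
  ultimately show ?thesis by (metis mult_1_right power_Suc)
qed (use card_field_gt_1[where 'a='a] in auto)

lemma to_ac_power_card: "to_ac (a :: 'a::{field,finite}) ^ CARD('a) = to_ac a"
  by (metis finite_field_power_card to_ac_power)

lemma degree_X_plus_1_power: "degree ([:1, 1:] ^ n :: 'b::field poly) = n"
  by (simp add: degree_power_eq)

text \<open>
  \<open>(X + 1)^q - X^q - 1\<close> has degree less than \<open>q\<close> and vanishes on all of the base field; so there is
  no need to know that \<open>q\<close> is a power of the characteristic.
\<close>

lemma frob_add_1:
  fixes x :: "'a::{field,finite} alg_closure"
  shows "(x + 1) ^ CARD('a) = x ^ CARD('a) + 1"
proof -
  let ?q = "CARD('a)"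
  define P :: "'a alg_closure poly" where "P = [:1, 1:] ^ ?q - monom 1 ?q - 1"
  have q: "?q > 0" by simp
  have deg1: "degree ([:1, 1:] ^ ?q :: 'a alg_closure poly) = ?q"
    by (rule degree_X_plus_1_power)
  have lc1: "coeff ([:1, 1:] ^ ?q :: 'a alg_closure poly) ?q = 1"
    using lead_coeff_power[of "[:1,1:] :: 'a alg_closure poly" ?q] deg1 by simp
  have cf: "coeff P i = 0" if "i \<ge> ?q" for i
  proof (cases "i = ?q")
    case True thus ?thesis using q lc1 by (simp add: P_def)
  next
    case False
    hence "i > degree ([:1, 1:] ^ ?q :: 'a alg_closure poly)" using that deg1 by simp
    thus ?thesis using that False q by (simp add: P_def coeff_eq_0)
  qed
  have "P = 0"
  proof (rule ccontr)
    assume "P \<noteq> 0"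
    hence dP: "degree P < ?q" using cf by (metis leading_coeff_0_iff not_le)
    have "range to_ac \<subseteq> {x. poly P x = 0}"
    proof safe
      fix a :: 'a
      have "to_ac (a + 1) ^ ?q = to_ac (a + 1)" by (rule to_ac_power_card)
      thus "poly P (to_ac a) = 0"
        by (simp add: P_def poly_power poly_monom to_ac_power_card add.commute)
    qed
    hence "card (range (to_ac :: 'a \<Rightarrow> _)) \<le> card {x. poly P x = 0}"
      by (intro card_mono poly_roots_finite \<open>P \<noteq> 0\<close>)
    also have "\<dots> \<le> degree P" using \<open>P \<noteq> 0\<close> by (rule card_poly_roots_bound)
    finally show False using dP by (simp add: card_image inj_to_ac)
  qed
  hence "poly P x = 0" by simp
  thus ?thesis by (simp add: P_def poly_power poly_monom algebra_simps)
qed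

lemma frob_add:
  fixes x y :: "'a::{field,finite} alg_closure"
  shows "(x + y) ^ CARD('a) = x ^ CARD('a) + y ^ CARD('a)"
proof (cases "y = 0")
  case False
  have "(x + y) = y * (x / y + 1)" using False by (simp add: field_simps)
  hence "(x + y) ^ CARD('a) = y ^ CARD('a) * ((x / y) ^ CARD('a) + 1)"
    by (metis frob_add_1 power_mult_distrib)
  thus ?thesis using False by (simp add: field_simps)
qed simp

lemma frob_pow_add:
  fixes x y :: "'a::{field,finite} alg_closure"
  shows "(x + y) ^ (CARD('a) ^ n) = x ^ (CARD('a) ^ n) + y ^ (CARD('a) ^ n)"
  by (induction n) (simp_all add: power_mult mult.commute[of "CARD('a)"] frob_add)

lemma frob_pow_sum:
  fixes f :: "'c \<Rightarrow> 'a::{field,finite} alg_closure"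
  shows "(\<Sum>x\<in>A. f x) ^ (CARD('a) ^ n) = (\<Sum>x\<in>A. f x ^ (CARD('a) ^ n))"
  by (induction A rule: infinite_finite_induct) (simp_all add: frob_pow_add)

lemma frob_pow_diff:
  fixes x y :: "'a::{field,finite} alg_closure"
  shows "(x - y) ^ (CARD('a) ^ n) = x ^ (CARD('a) ^ n) - y ^ (CARD('a) ^ n)"
  using frob_pow_add[of "x - y" y n] by (simp add: algebra_simps)

lemma frob_pow_inj:
  fixes x y :: "'a::{field,finite} alg_closure"
  assumes "x ^ (CARD('a) ^ n) = y ^ (CARD('a) ^ n)"
  shows "x = y"
  using frob_pow_diff[of x y n] assms by simp

lemma ev_frob:
  fixes p :: "'a::{field,finite} poly"
  shows "ev p x ^ (CARD('a) ^ n) = ev p (x ^ (CARD('a) ^ n))"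
proof (induction p)
  case (pCons a p)
  have "to_ac a ^ (CARD('a) ^ n) = to_ac a"
    by (induction n) (simp_all add: power_mult mult.commute[of "CARD('a)"] to_ac_power_card)
  thus ?case using pCons by (simp add: ev_pCons frob_pow_add power_mult_distrib)
qed simp

text \<open>Bounding coefficients instead of the degree keeps the zero polynomial in the set and
  covers \<open>n = 0\<close>; \<open>pCons\<close> then gives the recursion.\<close>

lemma card_poly_coeffs_below:
  "finite {r :: 'a::{field,finite} poly. \<forall>i\<ge>n. coeff r i = 0}
   \<and> card {r :: 'a poly. \<forall>i\<ge>n. coeff r i = 0} = CARD('a) ^ n"
proof (induction n)
  case 0
  have "{r :: 'a poly. \<forall>i\<ge>0. coeff r i = 0} = {0}" by (auto simp: poly_eq_iff)
  thus ?case by simp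
next
  case (Suc n)
  let ?S = "\<lambda>n. {r :: 'a poly. \<forall>i\<ge>n. coeff r i = 0}"
  have eq: "?S (Suc n) = (\<lambda>(a, r). pCons a r) ` (UNIV \<times> ?S n)"
  proof (rule equalityI; rule subsetI)
    fix r assume r: "r \<in> ?S (Suc n)"
    obtain a r' where ar: "r = pCons a r'" by (cases r)
    have "coeff r' i = 0" if "i \<ge> n" for i
      using r that unfolding ar by (auto dest!: spec[of _ "Suc i"])
    thus "r \<in> (\<lambda>(a, r). pCons a r) ` (UNIV \<times> ?S n)" using ar by auto
  next
    fix r assume "r \<in> (\<lambda>(a, r). pCons a r) ` (UNIV \<times> ?S n)"
    thus "r \<in> ?S (Suc n)" by (auto simp: coeff_pCons split: nat.splits)
  qed
  have inj: "inj_on (\<lambda>(a, r). pCons a r) (UNIV \<times> ?S n)" by (auto simp: inj_on_def)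
  show ?case unfolding eq using Suc.IH by (simp add: card_image[OF inj] card_cartesian_product)
qed

lemma fixed_points_frob:
  assumes "j > 0"
  shows "finite {x :: 'a::{field,finite} alg_closure. x ^ (CARD('a) ^ j) = x}" (is "finite ?S")
    and "card {x :: 'a::{field,finite} alg_closure. x ^ (CARD('a) ^ j) = x} \<le> CARD('a) ^ j"
proof -
  let ?P = "monom 1 (CARD('a) ^ j) - [:0, 1:] :: 'a alg_closure poly"
  have q: "CARD('a) ^ j > 1" using card_field_gt_1[where 'a='a] assms by (rule one_less_power)
  have "CARD('a) ^ j \<noteq> 0" "CARD('a) ^ j \<noteq> 1" using q by linarith+
  hence "coeff ?P (CARD('a) ^ j) = 1" by (simp add: coeff_pCons del: power_eq_0_iff split: nat.splits)
  hence nz: "?P \<noteq> 0" by (metis coeff_0 zero_neq_one)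
  have S: "?S = {x. poly ?P x = 0}" by (simp add: poly_monom)
  show "finite ?S" unfolding S using nz by (rule poly_roots_finite)
  have "degree ?P \<le> CARD('a) ^ j"
    by (rule degree_diff_le) (use q in \<open>auto simp: degree_monom_eq\<close>)
  thus "card ?S \<le> CARD('a) ^ j"
    unfolding S using card_poly_roots_bound[OF nz] by linarith
qed

section \<open>Residue fields and the roots of irreducible polynomials\<close>

lemma irreducible_poly_degree_pos:
  "irreducible (p :: 'a::field poly) \<Longrightarrow> degree p > 0"
  by (metis bot_nat_0.not_eq_extremum irreducible_def is_unit_iff_degree)

text \<open>The values at \<open>b\<close> form a copy of F_q[X]/(p): every value is taken by a
  remainder modulo \<open>p\<close>, and a difference of two remainders that vanishes at
  \<open>b\<close> is divisible by \<open>p\<close>, hence zero.\<close>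

lemma residue_field_image:
  fixes p :: "'a::{field_gcd,finite} poly"
  assumes p: "irreducible p" "ev p b = 0"
  shows "range (\<lambda>r. ev r b) = (\<lambda>r. ev r b) ` {r. \<forall>i\<ge>degree p. coeff r i = 0}"
    and "inj_on (\<lambda>r. ev r b) {r. \<forall>i\<ge>degree p. coeff r i = 0}"
proof -
  have p0: "p \<noteq> 0" "degree p > 0" using p irreducible_poly_degree_pos by auto
  have "ev r b \<in> (\<lambda>r. ev r b) ` {r. \<forall>i\<ge>degree p. coeff r i = 0}" for r
  proof -
    have "ev r b = ev (r div p * p + r mod p) b" by simp
    also have "\<dots> = ev (r mod p) b" using p by (simp only: ev_add ev_mult) simp
    finally have "ev r b = ev (r mod p) b" .
    moreover have "coeff (r mod p) i = 0" if "i \<ge> degree p" for i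
    proof (cases "r mod p = 0")
      case False
      hence "degree (r mod p) < degree p" using p0 degree_mod_less by blast
      thus ?thesis using that by (simp add: coeff_eq_0)
    qed simp
    ultimately show ?thesis by blast
  qed
  thus "range (\<lambda>r. ev r b) = (\<lambda>r. ev r b) ` {r. \<forall>i\<ge>degree p. coeff r i = 0}" by blast
  show "inj_on (\<lambda>r. ev r b) {r. \<forall>i\<ge>degree p. coeff r i = 0}"
  proof (rule inj_onI)
    fix r s assume rs: "r \<in> {r. \<forall>i\<ge>degree p. coeff r i = 0}" "s \<in> {r. \<forall>i\<ge>degree p. coeff r i = 0}"
      "ev r b = ev s b"
    hence "ev (r - s) b = 0" by (simp add: ev_diff)
    hence dvd: "p dvd r - s" using irreducible_ev_root_dvd p by blast
    show "r = s"
    proof (rule ccontr)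
      assume "r \<noteq> s"
      hence nz: "r - s \<noteq> 0" by simp
      hence "degree p \<le> degree (r - s)" using dvd dvd_imp_degree_le by blast
      hence "lead_coeff (r - s) = 0" using rs by simp
      thus False using nz leading_coeff_0_iff by blast
    qed
  qed
qed

lemma card_residue_field:
  fixes p :: "'a::{field_gcd,finite} poly"
  assumes p: "irreducible p" "ev p b = 0"
  shows "finite (range (\<lambda>r. ev r b))" "card (range (\<lambda>r. ev r b)) = CARD('a) ^ degree p"
  using residue_field_image[OF p] card_poly_coeffs_below[of "degree p", where 'a='a]
  by (auto simp: card_image)

lemma residue_field_frob:
  fixes p :: "'a::{field_gcd,finite} poly"
  assumes p: "irreducible p" "ev p b = 0"
  shows "ev r b ^ (CARD('a) ^ degree p) = ev r b"
proof (cases "ev r b = 0")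
  case False
  let ?G = "range (\<lambda>r. ev r b) - {0}"
  have "ev r b ^ card ?G = 1"
  proof (rule finite_mult_closed_power_eq_1)
    fix x y assume "x \<in> ?G" "y \<in> ?G"
    then obtain s t where "x = ev s b" "y = ev t b" "x \<noteq> 0" "y \<noteq> 0" by auto
    thus "x * y \<in> ?G" by (auto intro!: range_eqI[of _ _ "s * t"] simp: ev_mult)
  qed (use False card_residue_field[OF p] in auto)
  moreover have "0 \<in> range (\<lambda>r. ev r b)" by (rule range_eqI[of _ _ 0]) simp
  hence "card ?G = CARD('a) ^ degree p - 1"
    using card_residue_field[OF p] by simp
  ultimately have "ev r b ^ (CARD('a) ^ degree p - 1) = 1" by simp
  moreover have "CARD('a) ^ degree p = Suc (CARD('a) ^ degree p - 1)" by simp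
  ultimately show ?thesis by (metis mult_1_right power_Suc)
next
  case True
  thus ?thesis by (simp add: power_0_left)
qed

text \<open>Fermat's little theorem puts the residue field among the fixed points, and these are
  roots of X^(q^e) - X with e = \<open>degree p\<close>, hence at most as many as the residue field
  has elements.\<close>

lemma residue_field_eq_fixed_points:
  fixes p :: "'a::{field_gcd,finite} poly"
  assumes p: "irreducible p" "ev p b = 0"
  shows "range (\<lambda>r. ev r b) = {x. x ^ (CARD('a) ^ degree p) = x}"
proof (rule card_seteq)
  have e: "degree p > 0" using irreducible_poly_degree_pos p by blast
  show "finite {x :: 'a alg_closure. x ^ (CARD('a) ^ degree p) = x}"
    by (rule fixed_points_frob[OF e])
  show "range (\<lambda>r. ev r b) \<subseteq> {x. x ^ (CARD('a) ^ degree p) = x}"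
    using residue_field_frob[OF p] by auto
  show "card {x :: 'a alg_closure. x ^ (CARD('a) ^ degree p) = x} \<le> card (range (\<lambda>r. ev r b))"
    using fixed_points_frob(2)[OF e, where 'a='a] card_residue_field[OF p] by simp
qed

lemma power_frob_fixed_mult:
  fixes x :: "'b::monoid_mult"
  assumes "x ^ (q ^ e) = x"
  shows "x ^ (q ^ (e * k)) = x"
  by (induction k) (simp_all add: power_add power_mult assms)

text \<open>For the forward direction let r be the remainder of \<open>j\<close> modulo
  \<open>degree p\<close>. If the q^r-th power map fixes \<open>b\<close>, it fixes every polynomial
  in \<open>b\<close>, that is q^(degree p) elements; for r > 0 it has at most q^r fixed points, and
  r < \<open>degree p\<close>.\<close>

lemma root_frob_fixed_iff:
  fixes p :: "'a::{field_gcd,finite} poly"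
  assumes p: "irreducible p" "ev p b = 0"
  shows "b ^ (CARD('a) ^ j) = b \<longleftrightarrow> degree p dvd j"
proof
  have be: "b ^ (CARD('a) ^ degree p) = b"
    using residue_field_frob[OF p, of "[:0, 1:]"] by simp
  {
    assume "degree p dvd j"
    thus "b ^ (CARD('a) ^ j) = b"
      using power_frob_fixed_mult[OF be] by (auto simp: dvd_def)
  next
    assume bj: "b ^ (CARD('a) ^ j) = b"
    let ?r = "j mod degree p"
    have e: "degree p > 0" using irreducible_poly_degree_pos p by blast
    have "b ^ (CARD('a) ^ j) = b ^ (CARD('a) ^ (degree p * (j div degree p)) * CARD('a) ^ ?r)"
      by (simp flip: power_add)
    also have "\<dots> = b ^ (CARD('a) ^ ?r)"
      by (simp only: power_mult[of b] power_frob_fixed_mult[OF be])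
    finally have br: "b ^ (CARD('a) ^ ?r) = b" using bj by simp
    have "?r = 0"
    proof (rule ccontr)
      assume "?r \<noteq> 0"
      hence r: "?r > 0" by simp
      have "range (\<lambda>r. ev r b) \<subseteq> {x. x ^ (CARD('a) ^ ?r) = x}"
        using br by (auto simp: ev_frob)
      hence "CARD('a) ^ degree p \<le> card {x :: 'a alg_closure. x ^ (CARD('a) ^ ?r) = x}"
        using card_residue_field[OF p] fixed_points_frob(1)[OF r, where 'a='a]
        by (metis card_mono)
      also have "\<dots> \<le> CARD('a) ^ ?r" by (rule fixed_points_frob(2)[OF r])
      finally have "degree p \<le> ?r"
        using card_field_gt_1[where 'a='a] by simp
      thus False using e by (meson mod_less_divisor not_le)
    qed
    thus "degree p dvd j" by auto
  }
qed

text \<open>Frobenius maps roots to roots, and a repetition among the first \<open>degree p\<close>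
  iterates would make \<open>b\<close> fixed by a power of Frobenius that the previous criterion
  forbids. So the iterates exhaust the roots, and \<open>p\<close> is separable.\<close>

lemma irreducible_ev_roots:
  fixes p :: "'a::{field_gcd,finite} poly"
  assumes p: "irreducible p" "ev p b = 0"
  shows "{x. ev p x = 0} = (\<lambda>i. b ^ (CARD('a) ^ i)) ` {..<degree p}"
    and "inj_on (\<lambda>i. b ^ (CARD('a) ^ i)) {..<degree p}"
proof -
  have *: False if "i < k" "k < degree p" "b ^ (CARD('a) ^ i) = b ^ (CARD('a) ^ k)" for i k
  proof -
    have "b ^ (CARD('a) ^ k) = (b ^ (CARD('a) ^ (k - i))) ^ (CARD('a) ^ i)"
      using that by (simp flip: power_mult power_add)
    hence "b ^ (CARD('a) ^ (k - i)) = b" using that frob_pow_inj by metis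
    hence "degree p dvd k - i" using root_frob_fixed_iff[OF p] by blast
    thus False using that by (auto dest!: dvd_imp_le)
  qed
  show inj: "inj_on (\<lambda>i. b ^ (CARD('a) ^ i)) {..<degree p}"
    by (rule inj_onI) (metis * lessThan_iff nat_neq_iff)
  have p0: "p \<noteq> 0" using p by auto
  have "(\<lambda>i. b ^ (CARD('a) ^ i)) ` {..<degree p} = {x. ev p x = 0}"
  proof (rule card_seteq)
    show "(\<lambda>i. b ^ (CARD('a) ^ i)) ` {..<degree p} \<subseteq> {x. ev p x = 0}"
      using p(2) by (auto simp: power_0_left simp flip: ev_frob)
    show "card {x. ev p x = 0} \<le> card ((\<lambda>i. b ^ (CARD('a) ^ i)) ` {..<degree p})"
      using card_ev_roots[OF p0] by (simp add: card_image[OF inj])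
  qed (use finite_ev_roots p0 in auto)
  thus "{x. ev p x = 0} = (\<lambda>i. b ^ (CARD('a) ^ i)) ` {..<degree p}" by simp
qed

lemma card_irreducible_ev_roots:
  fixes p :: "'a::{field_gcd,finite} poly"
  assumes p: "irreducible p"
  shows "card {x. ev p x = 0} = degree p"
proof -
  obtain b where b: "ev p b = 0" using ev_root_exists irreducible_poly_degree_pos p by blast
  show ?thesis using irreducible_ev_roots[OF p b] by (simp add: card_image)
qed

text \<open>With \<open>degree p\<close> distinct roots there is no room for multiplicities.\<close>

lemma proots_irreducible:
  fixes p :: "'a::{field_gcd,finite} poly"
  assumes p: "irreducible p"
  shows "proots (map_poly to_ac p) = mset_set {x. ev p x = 0}"
proof -
  have p0: "p \<noteq> 0" using p by auto
  have fin: "finite {x. ev p x = 0}" using p0 by (rule finite_ev_roots)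
  have sub: "mset_set {x. ev p x = 0} \<subseteq># proots (map_poly to_ac p)"
  proof (rule mset_subset_eqI)
    fix a
    show "count (mset_set {x. ev p x = 0}) a \<le> count (proots (map_poly to_ac p)) a"
    proof (cases "ev p a = 0")
      case True
      hence "order a (map_poly to_ac p) > 0" using p0 by (simp add: order_gt_0_iff ev_def)
      thus ?thesis using True fin p0 by simp
    qed simp
  qed
  have "size (proots (map_poly to_ac p)) \<le> size (mset_set {x. ev p x = 0})"
    using size_proots_le[of "map_poly to_ac p"] card_irreducible_ev_roots[OF p] by simp
  thus ?thesis using sub by (metis leD mset_subset_size subset_mset.le_imp_less_or_eq)
qed

lemma proots_splits:
  fixes p :: "'b::alg_closed_field poly"
  assumes "p \<noteq> 0"
  shows "p = smult (lead_coeff p) (\<Prod>x\<in>#proots p. [:-x, 1:])" "size (proots p) = degree p"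
proof -
  obtain A where A: "size A = degree p" "p = smult (lead_coeff p) (\<Prod>x\<in>#A. [:-x, 1:])"
    using alg_closed_imp_factorization[OF assms] by blast
  have "proots (\<Prod>x\<in>#A. [:-x, 1:]) = A"
  proof (induction A)
    case (add x A)
    have "(\<Prod>x\<in>#A. [:-x, 1:]) \<noteq> (0 :: 'b poly)" by (auto simp: prod_mset_zero_iff)
    hence "proots ([:-x, 1:] * (\<Prod>x\<in>#A. [:-x, 1:])) = {#x#} + A"
      by (subst proots_mult) (simp_all add: add.IH)
    thus ?case by simp
  qed simp
  hence "proots p = A" using A(2) assms by (metis proots_smult leading_coeff_0_iff)
  thus "p = smult (lead_coeff p) (\<Prod>x\<in>#proots p. [:-x, 1:])" "size (proots p) = degree p"
    using A by simp_all
qed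

text \<open>\<open>prime\<close> and \<open>prime_factorization\<close> deliver normalised
  polynomials, whereas the L-series runs over monic ones; over a field the two notions
  agree.\<close>

lemma monic_iff_normalize:
  fixes p :: "'a::field_gcd poly"
  assumes "p \<noteq> 0"
  shows "normalize p = p \<longleftrightarrow> lead_coeff p = 1"
proof -
  have l: "lead_coeff p \<noteq> 0" using assms by simp
  hence "unit_factor (lead_coeff p) = lead_coeff p" by (simp add: is_unit_unit_factor dvd_field_iff)
  hence uf: "unit_factor p = [:lead_coeff p:]" by (simp add: unit_factor_poly_def monom_0)
  show ?thesis
  proof
    assume n: "normalize p = p"
    have "unit_factor p = 1" using n assms by (metis unit_factor_normalize)
    thus "lead_coeff p = 1" using uf by (simp add: one_pCons)
  next
    assume "lead_coeff p = 1"
    hence "unit_factor p = 1" using uf by (simp add: one_pCons)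
    thus "normalize p = p" by (metis div_by_1 normalize_def unit_factor_mult_normalize mult_1)
  qed
qed

text \<open>Translation by 1 permutes the base field, so comparing the sums of all elements gives q
  * 1 = 0; with q odd and 2 = 0 this would read 1 = 0.\<close>

lemma char_neq_2:
  assumes "odd CARD('a::{field,finite})"
  shows "(2 :: 'a alg_closure) \<noteq> 0"
proof
  assume "(2 :: 'a alg_closure) = 0"
  hence "to_ac (2 :: 'a) = 0" by simp
  hence two: "(2 :: 'a) = 0" by (simp del: to_ac_numeral)
  have "(\<Sum>x\<in>UNIV. x + 1) = (\<Sum>x\<in>UNIV. x :: 'a)"
    by (rule sum.reindex_bij_betw[of "\<lambda>x. x + 1" UNIV UNIV "\<lambda>x. x"])
       (auto simp: bij_betw_def inj_on_def intro!: range_eqI[of _ _ "_ - 1"])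
  hence "of_nat CARD('a) = (0 :: 'a)" by (simp add: sum.distrib)
  moreover obtain k where "CARD('a) = 2 * k + 1" using assms by (metis oddE)
  ultimately show False using two by simp
qed

section \<open>The quadratic character as a power\<close>

lemma field_card_odd_gt_2: "odd CARD('a::{field,finite}) \<Longrightarrow> CARD('a) > 2"
  using card_field_gt_1[where 'a='a] by (metis One_nat_def Suc_lessI even_numeral numeral_2_eq_2)

lemma poly_legendre_cases: "poly_legendre d p \<in> {-1, 0, 1}"
  by (simp add: poly_legendre_def)

text \<open>Euler's criterion, with the value of \<open>d\<close> at \<open>b\<close> standing for
  the class of \<open>d\<close> modulo \<open>p\<close>.\<close>

lemma poly_legendre_ev:
  fixes p d :: "'a::{field_gcd,finite} poly"
  assumes odd: "odd CARD('a)" and p: "irreducible p" "ev p b = 0"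
  shows "of_int (poly_legendre d p) = ev d b ^ ((CARD('a) ^ degree p - 1) div 2)"
proof -
  let ?Q = "CARD('a) ^ degree p"
  let ?h = "(?Q - 1) div 2"
  have e: "degree p > 0" using irreducible_poly_degree_pos p by blast
  have oddQ: "odd ?Q" using odd by simp
  have "CARD('a) ^ 1 \<le> ?Q" using e by (intro power_increasing) auto
  hence Q3: "?Q > 2" using field_card_odd_gt_2[OF odd] by simp
  have h2: "?h * 2 = ?Q - 1" using oddQ by simp
  have h0: "?h > 0" using Q3 h2 by linarith
  show ?thesis
  proof (cases "p dvd d")
    case True
    hence "ev d b = 0" using ev_eq_0_mono p by blast
    thus ?thesis using True h0 by (simp add: poly_legendre_def power_0_left)
  next
    case False
    hence nz: "ev d b \<noteq> 0" using irreducible_ev_root_dvd p by blast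
    have one: "x ^ (?Q - 1) = 1" if "x ^ ?Q = x" "x \<noteq> 0" for x :: "'a alg_closure"
    proof -
      have "x * x ^ (?Q - 1) = x * 1" using that Q3 by (simp flip: power_Suc)
      thus ?thesis using that by simp
    qed
    have "(ev d b ^ ?h) ^ 2 = 1"
      using one[OF residue_field_frob[OF p] nz] h2 by (simp flip: power_mult)
    hence pm: "ev d b ^ ?h = 1 \<or> ev d b ^ ?h = -1" by (simp add: power2_eq_1_iff)
    have iff: "(\<exists>y. p dvd (y ^ 2 - d)) \<longleftrightarrow> ev d b ^ ?h = 1"
    proof
      assume "\<exists>y. p dvd (y ^ 2 - d)"
      then obtain y where "p dvd (y ^ 2 - d)" by blast
      hence "ev (y ^ 2 - d) b = 0" using ev_eq_0_mono p by blast
      hence y: "ev d b = ev y b ^ 2" by (simp add: ev_diff ev_power)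
      have "ev d b ^ ?h = ev y b ^ (?h * 2)" unfolding y by (simp only: power_mult[symmetric] mult.commute)
      hence "ev d b ^ ?h = ev y b ^ (?Q - 1)" unfolding h2 .
      also have "\<dots> = 1" using y nz by (intro one residue_field_frob[OF p]) auto
      finally show "ev d b ^ ?h = 1" .
    next
      assume h: "ev d b ^ ?h = 1"
      \<comment> \<open>A square root is available at first only in the closure. The assumption
        \<open>h\<close> forces \<open>w ^ ?Q = w\<close>, so it lies in the residue field and is
        the value of a polynomial.\<close>
      obtain w where w: "w ^ 2 = ev d b" using nth_root_exists[of 2 "ev d b"] by auto
      have "w ^ (?h * 2) = 1" using h unfolding w[symmetric] by (simp only: power_mult[symmetric] mult.commute)
      hence "w ^ (?Q - 1) = 1" unfolding h2 .
      moreover have "?Q = Suc (?Q - 1)" using Q3 by simp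
      ultimately have "w ^ ?Q = w" by (metis mult_1_right power_Suc)
      hence "w \<in> range (\<lambda>r. ev r b)" using residue_field_eq_fixed_points[OF p] by blast
      then obtain r where "w = ev r b" by blast
      hence "ev (r ^ 2 - d) b = 0" using w by (simp add: ev_diff ev_power)
      thus "\<exists>y. p dvd (y ^ 2 - d)" using irreducible_ev_root_dvd p by blast
    qed
    show ?thesis using False iff pm by (auto simp: poly_legendre_def)
  qed
qed

lemma geometric_sum_nat: 
  assumes "q > 0"
  shows "(q - 1) * (\<Sum>i<n. q ^ i) = q ^ n - (1::nat)"
proof -
  obtain r where r: "q = Suc r" using assms by (cases q) auto
  have "r * (\<Sum>i<n. q ^ i) + 1 = q ^ n"
    by (induction n) (auto simp: r algebra_simps)
  thus ?thesis using r by simp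
qed

lemma prod_ev_irreducible_roots:
  fixes p d :: "'a::{field_gcd,finite} poly"
  assumes p: "irreducible p" "ev p b = 0"
  shows "(\<Prod>x\<in>{x. ev p x = 0}. ev d x) = ev d b ^ (\<Sum>i<degree p. CARD('a) ^ i)"
proof -
  have "(\<Prod>x\<in>{x. ev p x = 0}. ev d x) = (\<Prod>i<degree p. ev d (b ^ (CARD('a) ^ i)))"
    unfolding irreducible_ev_roots(1)[OF p] by (subst prod.reindex[OF irreducible_ev_roots(2)[OF p]]) simp
  also have "\<dots> = (\<Prod>i<degree p. ev d b ^ (CARD('a) ^ i))" by (simp add: ev_frob)
  finally show ?thesis by (simp add: power_sum)
qed

text \<open>In Euler's criterion (q^e - 1)/2 = (1 + q + ... + q^(e-1)) (q - 1)/2, and the power with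
  the first factor is the norm, the product over the conjugates. The exponent left over does not
  depend on \<open>p\<close>, so the formula multiplies up to composite moduli.\<close>

lemma poly_legendre_prod_roots:
  fixes p d :: "'a::{field_gcd,finite} poly"
  assumes odd: "odd CARD('a)" and p: "irreducible p"
  shows "of_int (poly_legendre d p) = (\<Prod>x\<in>{x. ev p x = 0}. ev d x) ^ ((CARD('a) - 1) div 2)"
proof -
  obtain b where b: "ev p b = 0" using ev_root_exists irreducible_poly_degree_pos p by blast
  let ?s = "\<Sum>i<degree p. CARD('a) ^ i"
  have "?s * ((CARD('a) - 1) div 2) * 2 = (CARD('a) - 1) * ?s" using odd by simp
  also have "\<dots> = CARD('a) ^ degree p - 1" by (rule geometric_sum_nat) simp
  finally have "?s * ((CARD('a) - 1) div 2) = (CARD('a) ^ degree p - 1) div 2" by simp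
  thus ?thesis unfolding prod_ev_irreducible_roots[OF p b] poly_legendre_ev[OF odd p b]
    by (simp flip: power_mult)
qed

lemma kronecker_poly_prod_mset:
  "kronecker_poly d m = (\<Prod>p\<in>#prime_factorization m. poly_legendre d p)"
  unfolding kronecker_poly_def
  by (subst image_prod_mset_multiplicity) (auto intro!: prod.cong simp: count_prime_factorization in_prime_factors_iff)

lemma kronecker_poly_prod_roots:
  fixes m d :: "'a::{field_gcd,finite} poly"
  assumes odd: "odd CARD('a)" and m: "lead_coeff m = 1"
  shows "of_int (kronecker_poly d m) =
    (\<Prod>x\<in>#proots (map_poly to_ac m). ev d x) ^ ((CARD('a) - 1) div 2)"
proof -
  have m0: "m \<noteq> 0" using m by auto
  have "(\<forall>p\<in>#A. irreducible p) \<Longrightarrow> of_int (\<Prod>p\<in>#A. poly_legendre d p) =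
     (\<Prod>x\<in>#proots (map_poly to_ac (prod_mset A)). ev d x) ^ ((CARD('a) - 1) div 2)"
    for A :: "'a poly multiset"
  proof (induction A)
    case (add p A)
    hence p: "irreducible p" by simp
    have nz: "p \<noteq> 0" "prod_mset A \<noteq> 0" using add.prems by (auto simp: prod_mset_zero_iff)
    have "proots (map_poly to_ac (p * prod_mset A)) =
       proots (map_poly to_ac p) + proots (map_poly to_ac (prod_mset A))"
      unfolding poly_to_ac_mult using nz by (intro proots_mult) auto
    thus ?case using add poly_legendre_prod_roots[OF odd p, of d]
      by (simp add: proots_irreducible[OF p] power_mult_distrib prod_unfold_prod_mset)
  qed (simp add: map_poly_1)
  moreover have "prod_mset (prime_factorization m) = m"
    using prod_mset_prime_factorization[OF m0] monic_iff_normalize[OF m0] m by simp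
  moreover have "\<forall>p\<in>#prime_factorization m. irreducible p"
    by (metis in_prime_factors_imp_prime prime_elem_imp_irreducible prime_imp_prime_elem)
  ultimately show ?thesis unfolding kronecker_poly_prod_mset by metis
qed

lemma ev_eq_prod_proots:
  fixes m :: "'a::field poly"
  assumes "m \<noteq> 0"
  shows "ev m y = to_ac (lead_coeff m) * (\<Prod>x\<in>#proots (map_poly to_ac m). y - x)"
proof -
  have "map_poly to_ac m = smult (to_ac (lead_coeff m)) (\<Prod>x\<in>#proots (map_poly to_ac m). [:-x, 1:])"
    using proots_splits(1)[of "map_poly to_ac m"] assms by (simp add: coeff_map_poly)
  hence "ev m y = to_ac (lead_coeff m) * poly (\<Prod>x\<in>#proots (map_poly to_ac m). [:-x, 1:]) y"
    unfolding ev_def by (metis poly_smult)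
  moreover have "poly (\<Prod>x\<in>#A. [:-x, 1:]) y = (\<Prod>x\<in>#A. y - x)" for A
    by (induction A) (simp_all add: algebra_simps)
  ultimately show ?thesis by simp
qed

lemma prod_mset_uminus_swap:
  "(\<Prod>x\<in>#A. \<Prod>y\<in>#B. x - (y::'b::comm_ring_1)) = (-1) ^ (size A * size B) * (\<Prod>y\<in>#B. \<Prod>x\<in>#A. y - x)"
proof (induction A)
  case (add a A)
  have 1: "(\<Prod>y\<in>#B. a - y) = (-1) ^ size B * (\<Prod>y\<in>#B. y - a)"
  proof (induction B)
    case (add b B)
    thus ?case by (simp add: algebra_simps)
  qed simp
  have 2: "(\<Prod>y\<in>#B. (y - a) * (\<Prod>x\<in>#A. y - x)) = (\<Prod>y\<in>#B. y - a) * (\<Prod>y\<in>#B. \<Prod>x\<in>#A. y - x)"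
    by (simp add: prod_mset.distrib)
  show ?case
    by (simp only: image_mset_add_mset prod_mset.add_mset size_add_mset add.IH 1 2 mult_Suc power_add) (simp only: mult_ac)
qed simp

text \<open>
  This is the only form of reciprocity that is needed: both sides are a resultant of \<open>m\<close> and \<open>d\<close>,
  so for fixed degree the symbol depends on \<open>m\<close> only modulo \<open>d\<close>.
\<close>

lemma kronecker_poly_reciprocity:
  fixes m d :: "'a::{field_gcd,finite} poly"
  assumes odd: "odd CARD('a)" and m: "lead_coeff m = 1" and d: "d \<noteq> 0"
  shows "of_int (kronecker_poly d m) =
    (to_ac (lead_coeff d) ^ degree m * (-1) ^ (degree m * degree d) *
      (\<Prod>y\<in>#proots (map_poly to_ac d). ev m y)) ^ ((CARD('a) - 1) div 2)"
proof -
  have m0: "m \<noteq> 0" using m by auto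
  let ?A = "proots (map_poly to_ac m)" and ?B = "proots (map_poly to_ac d)"
  have sz: "size ?A = degree m" "size ?B = degree d"
    using proots_splits(2)[of "map_poly to_ac m"] proots_splits(2)[of "map_poly to_ac d"] m0 d by simp_all
  have "(\<Prod>x\<in>#?A. ev d x) = (\<Prod>x\<in>#?A. to_ac (lead_coeff d) * (\<Prod>y\<in>#?B. x - y))"
    by (simp add: ev_eq_prod_proots[OF d])
  also have "\<dots> = to_ac (lead_coeff d) ^ degree m * (\<Prod>x\<in>#?A. \<Prod>y\<in>#?B. x - y)"
    by (simp add: prod_mset.distrib prod_mset_constant sz)
  also have "(\<Prod>x\<in>#?A. \<Prod>y\<in>#?B. x - y) = (-1) ^ (degree m * degree d) * (\<Prod>y\<in>#?B. \<Prod>x\<in>#?A. y - x)"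
    by (simp only: prod_mset_uminus_swap[of _ ?A] sz)
  also have "(\<Prod>y\<in>#?B. \<Prod>x\<in>#?A. y - x) = (\<Prod>y\<in>#?B. ev m y)"
    by (simp add: ev_eq_prod_proots[OF m0] m)
  finally show ?thesis unfolding kronecker_poly_prod_roots[OF odd m] by (simp add: mult.assoc)
qed

section \<open>Vanishing of the character sums in high degree\<close>

lemma exists_nonresidue:
  fixes p :: "'a::{field_gcd,finite} poly"
  assumes odd: "odd CARD('a)" and p: "irreducible p"
  shows "\<exists>s. poly_legendre s p = -1"
proof (rule ccontr)
  assume contr: "\<not> ?thesis"
  obtain b where b: "ev p b = 0" using ev_root_exists irreducible_poly_degree_pos p by blast
  let ?Q = "CARD('a) ^ degree p"
  let ?h = "(?Q - 1) div 2"
  have e: "degree p > 0" using irreducible_poly_degree_pos p by blast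
  have "CARD('a) ^ 1 \<le> ?Q" using e by (intro power_increasing) auto
  hence Q3: "?Q > 2" using field_card_odd_gt_2[OF odd] by simp
  \<comment> \<open>If no symbol were -1, all Q - 1 nonzero elements of the residue field would be
    roots of X^((Q-1)/2) - 1, too many for its degree.\<close>
  let ?P = "monom 1 ?h - 1 :: 'a alg_closure poly"
  have h: "?h > 0" "?h < ?Q - 1" using Q3 by linarith+
  hence "coeff ?P ?h = 1" by (simp add: coeff_1)
  hence P0: "?P \<noteq> 0" by (metis coeff_0 zero_neq_one)
  have "degree ?P \<le> ?h" by (rule degree_diff_le) (auto simp: degree_monom_eq)
  have "range (\<lambda>r. ev r b) - {0} \<subseteq> {x. poly ?P x = 0}"
  proof
    fix x assume "x \<in> range (\<lambda>r. ev r b) - {0}"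
    then obtain s where s: "x = ev s b" "x \<noteq> 0" by blast
    hence "\<not> p dvd s" using ev_eq_0_mono b by blast
    hence "poly_legendre s p = 1" using contr poly_legendre_cases[of s p]
      by (auto simp: poly_legendre_def split: if_splits)
    hence "x ^ ?h = 1" using poly_legendre_ev[OF odd p b, of s] s by simp
    thus "x \<in> {x. poly ?P x = 0}" by (simp add: poly_monom)
  qed
  hence "card (range (\<lambda>r. ev r b) - {0}) \<le> card {x. poly ?P x = 0}"
    by (intro card_mono poly_roots_finite P0)
  also have "\<dots> \<le> ?h" using card_poly_roots_bound[OF P0] \<open>degree ?P \<le> ?h\<close> by linarith
  also have "card (range (\<lambda>r. ev r b) - {0}) = ?Q - 1"
  proof -
    have "0 \<in> range (\<lambda>r. ev r b)" by (rule range_eqI[of _ _ 0]) simp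
    thus ?thesis using card_residue_field[OF p b] by simp
  qed
  finally show False using h by linarith
qed

lemma prod_mset_eq_1:
  "(\<And>x. x \<in># A \<Longrightarrow> f x = 1) \<Longrightarrow> (\<Prod>x\<in>#A. f x) = (1::'b::comm_monoid_mult)"
  by (induction A) auto

text \<open>Chinese remaindering: for a prime factor \<open>P\<close> of \<open>d\<close>, coprime
  to its cofactor \<open>g\<close> because \<open>d\<close> is squarefree, take \<open>r\<close>
  congruent to a nonresidue modulo \<open>P\<close> and to 1 modulo \<open>g\<close>. Only the roots
  of \<open>P\<close> then contribute to the product.\<close>

lemma exists_nontrivial_residue:
  fixes d :: "'a::{field_gcd,finite} poly"
  assumes odd: "odd CARD('a)" and d: "squarefree d" "degree d > 0"
  shows "\<exists>r. (\<Prod>y\<in>#proots (map_poly to_ac d). ev r y) ^ ((CARD('a) - 1) div 2) = -1"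
proof -
  have d0: "d \<noteq> 0" using d by auto
  have "\<not> is_unit d" using d is_unit_iff_degree[OF d0] by simp
  then obtain P where P: "prime P" "P dvd d" using prime_divisor_exists[OF d0] by blast
  have irr: "irreducible P" using P by (simp add: prime_elem_imp_irreducible)
  obtain g where g: "d = P * g" using P by (auto simp: dvd_def)
  have g0: "g \<noteq> 0" "P \<noteq> 0" using g d0 by auto
  have "\<not> P dvd g"
  proof
    assume "P dvd g"
    hence "P ^ 2 dvd d" unfolding g power2_eq_square by (intro mult_dvd_mono) auto
    hence "is_unit P" using d by (simp add: squarefree_def)
    thus False using P by (simp add: prime_def prime_elem_def)
  qed
  hence "coprime P g" using P by (simp add: prime_elem_imp_coprime)
  then obtain u v where uv: "u * P + v * g = 1"
    by (metis bezout_coefficients_fst_snd coprime_imp_gcd_eq_1)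
  obtain s where s: "poly_legendre s P = -1" using exists_nonresidue[OF odd irr] by blast
  define r where "r = s * (v * g) + u * P"
  have rP: "ev r y = ev s y" if "ev P y = 0" for y
  proof -
    have "ev (u * P + v * g) y = 1" using uv by simp
    hence "ev (v * g) y = 1" using that by (simp add: ev_add ev_mult)
    thus ?thesis unfolding r_def using that by (simp add: ev_add ev_mult)
  qed
  have rg: "ev r y = 1" if "ev g y = 0" for y
  proof -
    have "ev (u * P + v * g) y = 1" using uv by simp
    thus ?thesis unfolding r_def using that by (simp add: ev_add ev_mult)
  qed
  have "proots (map_poly to_ac d) = proots (map_poly to_ac P) + proots (map_poly to_ac g)"
    unfolding g poly_to_ac_mult by (intro proots_mult) (use g0 in auto)
  hence "(\<Prod>y\<in>#proots (map_poly to_ac d). ev r y) =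
     (\<Prod>y\<in>#proots (map_poly to_ac P). ev r y) * (\<Prod>y\<in>#proots (map_poly to_ac g). ev r y)"
    by simp
  also have "(\<Prod>y\<in>#proots (map_poly to_ac g). ev r y) = 1"
    by (intro prod_mset_eq_1 rg) (use g0 in \<open>simp add: ev_def\<close>)
  also have "(\<Prod>y\<in>#proots (map_poly to_ac P). ev r y) = (\<Prod>y\<in>{x. ev P x = 0}. ev s y)"
    unfolding proots_irreducible[OF irr] prod_unfold_prod_mset[symmetric]
    by (intro prod.cong) (use rP in auto)
  finally have "(\<Prod>y\<in>#proots (map_poly to_ac d). ev r y) ^ ((CARD('a) - 1) div 2) =
     of_int (poly_legendre s P)" using poly_legendre_prod_roots[OF odd irr] by simp
  thus ?thesis using s by auto
qed

lemma kronecker_poly_cases: "kronecker_poly d m \<in> {-1, 0, 1}"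
proof -
  have "(\<Prod>p\<in>#A. poly_legendre d p) \<in> {-1, 0, 1}" for A
  proof (induction A)
    case (add p A)
    thus ?case using poly_legendre_cases[of d p] by auto
  qed simp
  thus ?thesis by (simp add: kronecker_poly_prod_mset)
qed

lemma monic_of_degree_iff:
  "m \<in> monic_of_degree n \<longleftrightarrow> coeff m n = 1 \<and> (\<forall>i>n. coeff m i = 0)"
proof
  assume "m \<in> monic_of_degree n"
  thus "coeff m n = 1 \<and> (\<forall>i>n. coeff m i = 0)" by (auto simp: monic_of_degree_def coeff_eq_0)
next
  assume *: "coeff m n = 1 \<and> (\<forall>i>n. coeff m i = 0)"
  hence "degree m \<le> n" by (intro degree_le) auto
  moreover have "n \<le> degree m" using * by (intro le_degree) auto
  ultimately show "m \<in> monic_of_degree n" using * by (simp add: monic_of_degree_def)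
qed

lemma finite_monic_of_degree: "finite (monic_of_degree n :: 'a::{field_gcd,finite} poly set)"
  by (rule finite_subset[of _ "{r. \<forall>i\<ge>Suc n. coeff r i = 0}"])
     (use card_poly_coeffs_below[of "Suc n", where 'a='a] in \<open>auto simp: monic_of_degree_iff\<close>)

definition char_sum :: "'a::{field_gcd,finite} poly \<Rightarrow> nat \<Rightarrow> int" where
  "char_sum d n = (\<Sum>m\<in>monic_of_degree n. kronecker_poly d m)"

text \<open>Lifts an identity from the closure to the integers: a sum of two symbols has absolute
  value at most 2, so it is enough that the characteristic is not 2.\<close>

lemma of_int_small_eq_0:
  assumes "(2 :: 'b::field) \<noteq> 0" "of_int k = (0 :: 'b)" "\<bar>k\<bar> \<le> 2"
  shows "k = 0"
proof -
  have "k \<in> {-2, -1, 0, 1, 2}" using assms(3) by auto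
  thus ?thesis using assms(1,2) by auto
qed

text \<open>Some permutation of the monic polynomials of degree \<open>n\<close> changes the sign of
  every symbol: multiply the residue modulo \<open>d\<close> by the \<open>r\<close> of the
  preceding lemma. By reciprocity the symbol picks up exactly the factor -1.\<close>

lemma char_sum_eq_0:
  fixes d :: "'a::{field_gcd,finite} poly"
  assumes odd: "odd CARD('a)" and d: "squarefree d" "degree d > 0" and n: "n \<ge> degree d"
  shows "char_sum d n = 0"
proof -
  have d0: "d \<noteq> 0" using d by auto
  let ?B = "proots (map_poly to_ac d)" and ?h = "(CARD('a) - 1) div 2"
  have h: "?h > 0" using field_card_odd_gt_2[OF odd] by simp
  obtain r where r: "(\<Prod>y\<in>#?B. ev r y) ^ ?h = -1"
    using exists_nontrivial_residue[OF odd d] by blast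
  have memB: "y \<in># ?B \<longleftrightarrow> ev d y = 0" for y using d0 by (simp add: ev_def)
  have cop: "coprime d r"
  proof (rule ccontr)
    assume "\<not> coprime d r"
    hence "\<not> is_unit (gcd d r)" by (simp add: coprime_iff_gcd_eq_1)
    moreover have "gcd d r \<noteq> 0" using d0 by simp
    ultimately have "degree (gcd d r) > 0" using is_unit_iff_degree by blast
    then obtain y where y: "ev (gcd d r) y = 0" using ev_root_exists by blast
    have "ev d y = 0" "ev r y = 0" using ev_eq_0_mono[OF _ y] by simp_all
    hence "(\<Prod>y\<in>#?B. ev r y) = 0" using memB[of y] by (auto simp: prod_mset_zero_iff image_iff)
    hence "(\<Prod>y\<in>#?B. ev r y) ^ ?h = 0" using h by (simp only: power_0_left) simp
    thus False using r by (metis neg_equal_0_iff_equal zero_neq_one)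
  qed
  \<comment> \<open>Only coefficients below \<open>degree d\<close> change, so for
    \<open>n \<ge> degree d\<close> the result is still monic of degree \<open>n\<close>, unlike the
    product \<open>r * m\<close> itself.\<close>
  define T where "T = (\<lambda>m. m - m mod d + (r * m) mod d)"
  have small: "coeff (f mod d) i = 0" if "i \<ge> degree d" for f :: "'a poly" and i
  proof (cases "f mod d = 0")
    case False
    hence "degree (f mod d) < degree d" using d0 degree_mod_less by blast
    thus ?thesis using that by (simp add: coeff_eq_0)
  qed simp
  have T_in: "T m \<in> monic_of_degree n" if "m \<in> monic_of_degree n" for m
    using that n small by (auto simp: monic_of_degree_iff T_def)
  have T_mod: "T m mod d = (r * m) mod d" for m
  proof -
    have "T m = m div d * d + (r * m) mod d" unfolding T_def by (simp add: minus_mod_eq_div_mult)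
    thus ?thesis by (simp only: mod_mult_self3 mod_mod_trivial)
  qed
  have "inj_on T (monic_of_degree n)"
  proof (rule inj_onI)
    fix m m' assume eq: "T m = T m'"
    hence e2: "(r * m) mod d = (r * m') mod d" using T_mod by metis
    hence "d dvd r * (m - m')" by (simp add: mod_eq_dvd_iff right_diff_distrib)
    hence "d dvd m - m'" using cop by (simp add: coprime_dvd_mult_right_iff)
    hence "m mod d = m' mod d" by (simp add: mod_eq_dvd_iff)
    thus "m = m'" using eq e2 by (simp add: T_def)
  qed
  hence bij: "bij_betw T (monic_of_degree n) (monic_of_degree n)"
    unfolding bij_betw_def using T_in finite_monic_of_degree
    by (metis endo_inj_surj image_subsetI)
  have chi: "kronecker_poly d (T m) = - kronecker_poly d m" if m: "m \<in> monic_of_degree n" for m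
  proof -
    have ev_mod: "ev (f mod d) y = ev f y" if "y \<in># ?B" for f y
    proof -
      have "ev (f div d * d + f mod d) y = ev (f mod d) y"
        using that memB by (simp only: ev_add ev_mult) simp
      thus ?thesis by simp
    qed
    have "(\<Prod>y\<in>#?B. ev (T m) y) = (\<Prod>y\<in>#?B. ev r y * ev m y)"
      unfolding T_def by (intro arg_cong[where f = prod_mset] image_mset_cong) (simp add: ev_add ev_diff ev_mod ev_mult)
    hence P: "(\<Prod>y\<in>#?B. ev (T m) y) = (\<Prod>y\<in>#?B. ev r y) * (\<Prod>y\<in>#?B. ev m y)"
      by (simp add: prod_mset.distrib)
    have m1: "lead_coeff m = 1" "degree m = n" and T1: "lead_coeff (T m) = 1" "degree (T m) = n"
      using m T_in[OF m] by (auto simp: monic_of_degree_def)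
    have "(of_int (kronecker_poly d (T m)) :: 'a alg_closure) =
        (\<Prod>y\<in>#?B. ev r y) ^ ?h * of_int (kronecker_poly d m)"
      unfolding kronecker_poly_reciprocity[OF odd m1(1) d0] kronecker_poly_reciprocity[OF odd T1(1) d0] P m1(2) T1(2)
      by (simp only: power_mult_distrib mult_ac)
    hence "(of_int (kronecker_poly d (T m) + kronecker_poly d m) :: 'a alg_closure) = 0"
      using r by simp
    moreover have "\<bar>kronecker_poly d (T m) + kronecker_poly d m\<bar> \<le> 2"
      using kronecker_poly_cases[of d m] kronecker_poly_cases[of d "T m"] by auto
    ultimately have "kronecker_poly d (T m) + kronecker_poly d m = 0"
      using of_int_small_eq_0 char_neq_2[OF odd] by blast
    thus ?thesis by simp
  qed
  have "char_sum d n = (\<Sum>m\<in>monic_of_degree n. kronecker_poly d (T m))"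
    unfolding char_sum_def by (rule sum.reindex_bij_betw[OF bij, symmetric])
  also have "\<dots> = - char_sum d n" unfolding char_sum_def by (simp add: chi sum_negf)
  finally show ?thesis by simp
qed

section \<open>Euler product and Newton's identities\<close>

definition primes_dividing :: "nat \<Rightarrow> 'a::{field_gcd,finite} poly set" where
  "primes_dividing j = {p. prime p \<and> degree p dvd j}"

text \<open>This is the sum of Lambda(f) chi_d(f) over monic f of degree \<open>j\<close>, where
  Lambda(p^k) = \<open>degree p\<close>, in other words the coefficient of u^j in u L'/L.\<close>

definition prime_power_sum :: "'a::{field_gcd,finite} poly \<Rightarrow> nat \<Rightarrow> int" where
  "prime_power_sum d j =
     (\<Sum>p\<in>primes_dividing j. int (degree p) * poly_legendre d p ^ (j div degree p))"

lemma prime_poly_props: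
  fixes p :: "'a::field_gcd poly"
  assumes "prime p"
  shows "irreducible p" "lead_coeff p = 1" "degree p > 0" "p \<noteq> 0"
proof -
  show irr: "irreducible p" using assms by (simp add: prime_elem_imp_irreducible)
  show p0: "p \<noteq> 0" using irr by auto
  show "lead_coeff p = 1" using assms monic_iff_normalize[OF p0] by (simp add: prime_def)
  show "degree p > 0" using irr irreducible_poly_degree_pos by blast
qed

lemma finite_primes_degree_le: "finite {p :: 'a::{field_gcd,finite} poly. prime p \<and> degree p \<le> n}"
  by (rule finite_subset[of _ "{r. \<forall>i\<ge>Suc n. coeff r i = 0}"])
     (use card_poly_coeffs_below[of "Suc n", where 'a='a] in \<open>auto simp: coeff_eq_0\<close>)

text \<open>The analogue of log = Lambda * 1: each prime power dividing \<open>m\<close> contributes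
  the degree of its prime. The bound on \<open>k * degree p\<close> places the pairs in a finite
  range common to all \<open>m\<close> of degree \<open>n\<close>.\<close>

lemma degree_eq_sum_prime_powers:
  fixes m :: "'a::{field_gcd,finite} poly"
  assumes m: "m \<in> monic_of_degree n"
  shows "(\<Sum>(p, k)\<in>{(p, k). prime p \<and> k \<ge> 1 \<and> k * degree p \<le> n \<and> p ^ k dvd m}. degree p) = n"
proof -
  have m1: "lead_coeff m = 1" "degree m = n" "m \<noteq> 0" using m by (auto simp: monic_of_degree_def)
  have set: "{(p, k). prime p \<and> k \<ge> 1 \<and> k * degree p \<le> n \<and> p ^ k dvd m} =
     Sigma (prime_factors m) (\<lambda>p. {1..multiplicity p m})"
  proof -
    have "(p, k) \<in> {(p, k). prime p \<and> k \<ge> 1 \<and> k * degree p \<le> n \<and> p ^ k dvd m} \<longleftrightarrow>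
      (p, k) \<in> Sigma (prime_factors m) (\<lambda>p. {1..multiplicity p m})" for p :: "'a poly" and k
    proof (cases "prime p")
      case True
      note pp = prime_poly_props[OF True]
      have nu: "\<not> is_unit p" using True by (simp add: prime_def prime_elem_def)
      have iff: "p ^ k dvd m \<longleftrightarrow> k \<le> multiplicity p m"
        using nu m1 by (simp add: power_dvd_iff_le_multiplicity)
      have "k * degree p \<le> n" if "p ^ k dvd m"
        using dvd_imp_degree_le[OF that m1(3)] m1 pp by (simp add: degree_power_eq mult.commute)
      moreover have "p dvd m" if "p ^ k dvd m" "k \<ge> 1"
        using that by (meson dvd_trans dvd_power le_less_trans less_numeral_extra(1) zero_less_one less_le_trans)
      ultimately show ?thesis using True iff m1 by (auto simp: in_prime_factors_iff)
    qed (auto simp: in_prime_factors_iff)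
    thus ?thesis by auto
  qed
  have "(\<Sum>(p, k)\<in>Sigma (prime_factors m) (\<lambda>p. {1..multiplicity p m}). degree p) =
    (\<Sum>p\<in>prime_factors m. \<Sum>k\<in>{1..multiplicity p m}. degree p)"
    by (rule sum.Sigma[symmetric]) auto
  also have "\<dots> = (\<Sum>p\<in>prime_factors m. multiplicity p m * degree p)" by simp
  also have "\<dots> = (\<Sum>p\<in>prime_factors m. degree (p ^ multiplicity p m))"
    by (intro sum.cong) (auto simp: degree_power_eq in_prime_factors_iff prime_poly_props mult.commute)
  also have "\<dots> = degree (\<Prod>p\<in>prime_factors m. p ^ multiplicity p m)"
    by (rule degree_prod_sum_eq[symmetric]) (auto simp: in_prime_factors_iff prime_poly_props)
  also have "(\<Prod>p\<in>prime_factors m. p ^ multiplicity p m) = m"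
    using prod_prime_factors[OF m1(3)] monic_iff_normalize[OF m1(3)] m1 by simp
  finally show ?thesis using set m1 by simp
qed

lemma kronecker_poly_mult:
  fixes m m' :: "'a::{field_gcd,finite} poly"
  assumes "m \<noteq> 0" "m' \<noteq> 0"
  shows "kronecker_poly d (m * m') = kronecker_poly d m * kronecker_poly d m'"
  using assms by (simp add: kronecker_poly_prod_mset prime_factorization_mult)

lemma kronecker_poly_prime_power:
  fixes p :: "'a::{field_gcd,finite} poly"
  assumes "prime p"
  shows "kronecker_poly d (p ^ k) = poly_legendre d p ^ k"
  using assms by (simp add: kronecker_poly_prod_mset prime_factorization_prime_power)

lemma sum_kronecker_poly_multiples:
  fixes d :: "'a::{field_gcd,finite} poly"
  assumes p: "prime p" and k: "k * degree p \<le> n"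
  shows "(\<Sum>m\<in>{m \<in> monic_of_degree n. p ^ k dvd m}. kronecker_poly d m) =
    poly_legendre d p ^ k * char_sum d (n - k * degree p)"
proof -
  note pp = prime_poly_props[OF p]
  have pk: "degree (p ^ k) = k * degree p" "lead_coeff (p ^ k) = 1" "p ^ k \<noteq> 0"
    using pp lead_coeff_power[of p k] by (simp_all add: degree_power_eq mult.commute)
  have set: "{m \<in> monic_of_degree n. p ^ k dvd m} = (*) (p ^ k) ` monic_of_degree (n - k * degree p)"
  proof (rule equalityI; rule subsetI)
    fix m assume "m \<in> {m \<in> monic_of_degree n. p ^ k dvd m}"
    then obtain m' where m': "m = p ^ k * m'" "lead_coeff m = 1" "degree m = n"
      by (auto simp: monic_of_degree_def dvd_def)
    hence "m' \<noteq> 0" by auto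
    hence "degree m' = n - k * degree p" "lead_coeff m' = 1"
      using m' pk by (auto simp: degree_mult_eq lead_coeff_mult)
    thus "m \<in> (*) (p ^ k) ` monic_of_degree (n - k * degree p)" using m' by (auto simp: monic_of_degree_def)
  next
    fix m assume "m \<in> (*) (p ^ k) ` monic_of_degree (n - k * degree p)"
    then obtain m' where m': "m = p ^ k * m'" "lead_coeff m' = 1" "degree m' = n - k * degree p"
      unfolding monic_of_degree_def by blast
    hence "m' \<noteq> 0" by auto
    hence "degree m = n" using m' pk k by (simp add: degree_mult_eq)
    moreover have "lead_coeff m = 1" unfolding m'(1) lead_coeff_mult using m' pk by simp
    ultimately show "m \<in> {m \<in> monic_of_degree n. p ^ k dvd m}" using m' by (auto simp: monic_of_degree_def)
  qed
  have inj: "inj_on ((*) (p ^ k)) (monic_of_degree (n - k * degree p))"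
    using pk by (auto simp: inj_on_def)
  have "(\<Sum>m\<in>{m \<in> monic_of_degree n. p ^ k dvd m}. kronecker_poly d m) =
    (\<Sum>m\<in>monic_of_degree (n - k * degree p). kronecker_poly d (p ^ k * m))"
    unfolding set by (subst sum.reindex[OF inj]) simp
  also have "\<dots> = (\<Sum>m\<in>monic_of_degree (n - k * degree p). poly_legendre d p ^ k * kronecker_poly d m)"
    by (intro sum.cong refl, subst kronecker_poly_mult)
       (use pk in \<open>auto simp: kronecker_poly_prime_power[OF p] monic_of_degree_def\<close>)
  finally show ?thesis by (simp add: char_sum_def sum_distrib_left)
qed

text \<open>The coefficients of u L' = (u L'/L) L, obtained by finite sums alone: weight each
  \<open>m\<close> by its degree, expand the degree over prime powers, exchange the sums, and group
  the pairs \<open>(p, k)\<close> by \<open>j = k * degree p\<close>.\<close>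

lemma newton_char_sum:
  fixes d :: "'a::{field_gcd,finite} poly"
  shows "int n * char_sum d n = (\<Sum>j\<in>{1..n}. prime_power_sum d j * char_sum d (n - j))"
proof -
  define PK where "PK = {(p :: 'a poly, k). prime p \<and> k \<ge> 1 \<and> k * degree p \<le> n}"
  have finPK: "finite PK"
  proof (rule finite_subset)
    show "PK \<subseteq> {p. prime p \<and> degree p \<le> n} \<times> {..n}"
    proof
      fix x assume "x \<in> PK"
      then obtain p k where x: "x = (p, k)" "prime p" "k \<ge> 1" "k * degree p \<le> n"
        by (auto simp: PK_def)
      have "degree p \<le> k * degree p" "k \<le> k * degree p"
        using x prime_poly_props(3)[OF x(2)] by auto
      hence "degree p \<le> n" "k \<le> n" using x(4) by linarith+
      thus "x \<in> {p. prime p \<and> degree p \<le> n} \<times> {..n}" using x by auto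
    qed
  qed (use finite_primes_degree_le in auto)
  have "int n * char_sum d n = (\<Sum>m\<in>monic_of_degree n. int n * kronecker_poly d m)"
    by (simp add: char_sum_def sum_distrib_left)
  also have "\<dots> = (\<Sum>m\<in>monic_of_degree n. \<Sum>(p, k)\<in>PK. if p ^ k dvd m then int (degree p) * kronecker_poly d m else 0)"
  proof (intro sum.cong refl)
    fix m :: "'a poly" assume m: "m \<in> monic_of_degree n"
    have "(\<Sum>(p, k)\<in>PK. if p ^ k dvd m then int (degree p) * kronecker_poly d m else 0) =
      (\<Sum>(p, k)\<in>{x \<in> PK. fst x ^ snd x dvd m}. int (degree p) * kronecker_poly d m)"
      by (subst sum.inter_filter[OF finPK]) (auto intro!: sum.cong)
    also have "{x \<in> PK. fst x ^ snd x dvd m} =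
      {(p, k). prime p \<and> k \<ge> 1 \<and> k * degree p \<le> n \<and> p ^ k dvd m}" by (auto simp: PK_def)
    also have "(\<Sum>(p, k)\<in>\<dots>. int (degree p) * kronecker_poly d m) =
       int (\<Sum>(p, k)\<in>{(p, k). prime p \<and> k \<ge> 1 \<and> k * degree p \<le> n \<and> p ^ k dvd m}. degree p) * kronecker_poly d m"
      by (simp add: sum_distrib_right case_prod_unfold)
    finally show "int n * kronecker_poly d m =
        (\<Sum>(p, k)\<in>PK. if p ^ k dvd m then int (degree p) * kronecker_poly d m else 0)"
      unfolding degree_eq_sum_prime_powers[OF m] by (rule sym)
  qed
  also have "\<dots> = (\<Sum>(p, k)\<in>PK. \<Sum>m\<in>monic_of_degree n. if p ^ k dvd m then int (degree p) * kronecker_poly d m else 0)"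
    by (subst sum.swap) (simp add: case_prod_unfold)
  also have "\<dots> = (\<Sum>(p, k)\<in>PK. int (degree p) * poly_legendre d p ^ k * char_sum d (n - k * degree p))"
  proof (intro sum.cong refl, clarify)
    fix p :: "'a poly" and k assume "(p, k) \<in> PK"
    hence pk: "prime p" "k * degree p \<le> n" by (auto simp: PK_def)
    have "(\<Sum>m\<in>monic_of_degree n. if p ^ k dvd m then int (degree p) * kronecker_poly d m else 0) =
       (\<Sum>m\<in>{m\<in>monic_of_degree n. p ^ k dvd m}. int (degree p) * kronecker_poly d m)"
      by (rule sum.inter_filter[OF finite_monic_of_degree, symmetric])
    thus "(\<Sum>m\<in>monic_of_degree n. if p ^ k dvd m then int (degree p) * kronecker_poly d m else 0) =
      int (degree p) * poly_legendre d p ^ k * char_sum d (n - k * degree p)"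
      using sum_kronecker_poly_multiples[OF pk, of d] by (simp flip: sum_distrib_left)
  qed
  also have "\<dots> = (\<Sum>(j, p)\<in>Sigma {1..n} primes_dividing.
       int (degree p) * poly_legendre d p ^ (j div degree p) * char_sum d (n - j))"
  proof (rule sum.reindex_bij_witness[of _ "\<lambda>(j, p). (p, j div degree p)" "\<lambda>(p, k). (k * degree p, p)"])
    fix x assume "x \<in> PK"
    then obtain p k where x: "x = (p, k)" "prime p" "k \<ge> 1" "k * degree p \<le> n"
      by (auto simp: PK_def)
    note dp = prime_poly_props(3)[OF x(2)]
    show "(case case x of (p, k) \<Rightarrow> (k * degree p, p) of (j, p) \<Rightarrow> (p, j div degree p)) = x"
      using x dp by simp
    show "(case x of (p, k) \<Rightarrow> (k * degree p, p)) \<in> Sigma {1..n} primes_dividing"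
      using x dp by (simp add: primes_dividing_def Suc_le_eq)
    show "(case case x of (p, k) \<Rightarrow> (k * degree p, p) of (j, p) \<Rightarrow>
          int (degree p) * poly_legendre d p ^ (j div degree p) * char_sum d (n - j)) =
        (case x of (p, k) \<Rightarrow> int (degree p) * poly_legendre d p ^ k * char_sum d (n - k * degree p))"
      using x dp by simp
  next
    fix x assume "x \<in> Sigma {1..n} (primes_dividing :: nat \<Rightarrow> 'a poly set)"
    then obtain j p where x: "x = (j, p)" "1 \<le> j" "j \<le> n" "prime p" "degree p dvd j"
      by (auto simp: primes_dividing_def)
    note dp = prime_poly_props(3)[OF x(4)]
    have "j div degree p \<ge> 1" using x dp by (metis One_nat_def Suc_leI div_greater_zero_iff dvd_imp_le less_le_trans zero_less_one)
    thus "(case x of (j, p) \<Rightarrow> (p, j div degree p)) \<in> PK" using x dp by (simp add: PK_def)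
    show "(case case x of (j, p) \<Rightarrow> (p, j div degree p) of (p, k) \<Rightarrow> (k * degree p, p)) = x"
      using x dp by simp
  qed
  also have "\<dots> = (\<Sum>j\<in>{1..n}. \<Sum>p\<in>primes_dividing j.
       int (degree p) * poly_legendre d p ^ (j div degree p) * char_sum d (n - j))"
  proof (rule sum.Sigma[symmetric])
    show "\<forall>j\<in>{1..n}. finite (primes_dividing j :: 'a poly set)"
      by (auto simp: primes_dividing_def intro!: finite_subset[OF _ finite_primes_degree_le[of n]] dest: dvd_imp_le)
  qed auto
  finally show ?thesis by (simp add: prime_power_sum_def sum_distrib_right)
qed

section \<open>Stepanov's method\<close>

lemma homogeneous_system_nontrivial_solution:
  fixes g :: "'k \<Rightarrow> nat \<Rightarrow> 'b::field"
  assumes "finite A" "card A > N"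
  shows "\<exists>c. (\<exists>k\<in>A. c k \<noteq> 0) \<and> (\<forall>i<N. (\<Sum>k\<in>A. c k * g k i) = 0)"
  using assms
proof (induction N arbitrary: A g)
  case 0
  hence "A \<noteq> {}" by auto
  thus ?case by (intro exI[of _ "\<lambda>_. 1"]) auto
next
  case (Suc N)
  show ?case
  proof (cases "\<forall>k\<in>A. g k N = 0")
    case True
    obtain c where c: "\<exists>k\<in>A. c k \<noteq> 0" "\<forall>i<N. (\<Sum>k\<in>A. c k * g k i) = 0"
      using Suc.IH[of A g] Suc.prems by auto
    have "(\<Sum>k\<in>A. c k * g k i) = 0" if "i < Suc N" for i
    proof (cases "i = N")
      case True thus ?thesis using \<open>\<forall>k\<in>A. g k N = 0\<close> by simp
    qed (use that c in auto)
    thus ?thesis using c by blast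
  next
    case False
    then obtain k0 where k0: "k0 \<in> A" "g k0 N \<noteq> 0" by blast
    let ?A = "A - {k0}"
    have "card ?A > N" using Suc.prems k0 by simp
    then obtain c where c: "\<exists>k\<in>?A. c k \<noteq> 0"
      "\<forall>i<N. (\<Sum>k\<in>?A. c k * (g k i - g k N / g k0 N * g k0 i)) = 0"
      using Suc.IH[of ?A "\<lambda>k i. g k i - g k N / g k0 N * g k0 i"] Suc.prems by auto
    \<comment> \<open>In the reduced system the pivot \<open>k0\<close> has been used to eliminate
      equation \<open>N\<close>; its own value is chosen so that this equation holds as
      well.\<close>
    define c' where "c' = c(k0 := - (\<Sum>k\<in>?A. c k * g k N) / g k0 N)"
    have sum: "(\<Sum>k\<in>A. c' k * g k i) = (\<Sum>k\<in>?A. c k * g k i) - (\<Sum>k\<in>?A. c k * g k N) / g k0 N * g k0 i" for i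
    proof -
      have "(\<Sum>k\<in>A. c' k * g k i) = c' k0 * g k0 i + (\<Sum>k\<in>?A. c' k * g k i)"
        using Suc.prems(1) k0(1) by (rule sum.remove)
      also have "(\<Sum>k\<in>?A. c' k * g k i) = (\<Sum>k\<in>?A. c k * g k i)"
        by (intro sum.cong) (auto simp: c'_def)
      finally show ?thesis by (simp add: c'_def)
    qed
    have "(\<Sum>k\<in>A. c' k * g k i) = 0" if "i < Suc N" for i
    proof (cases "i = N")
      case True thus ?thesis using k0 by (simp add: sum)
    next
      case False
      have "(\<Sum>k\<in>?A. c k * (g k i - g k N / g k0 N * g k0 i)) =
        (\<Sum>k\<in>?A. c k * g k i) - (\<Sum>k\<in>?A. c k * g k N) / g k0 N * g k0 i"
        by (simp add: right_diff_distrib sum_subtractf sum_distrib_right sum_divide_distrib mult.assoc)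
      moreover have "(\<Sum>k\<in>?A. c k * (g k i - g k N / g k0 N * g k0 i)) = 0"
        using c(2) False that by auto
      ultimately show ?thesis unfolding sum by metis
    qed
    moreover have "\<exists>k\<in>A. c' k \<noteq> 0" using c(1) by (auto simp: c'_def)
    ultimately show ?thesis by blast
  qed
qed

lemma poly_linear_dependence:
  fixes g :: "'k \<Rightarrow> 'b::field poly"
  assumes "finite A" "card A > N" "\<And>k. k \<in> A \<Longrightarrow> degree (g k) < N"
  shows "\<exists>c. (\<exists>k\<in>A. c k \<noteq> 0) \<and> (\<Sum>k\<in>A. smult (c k) (g k)) = 0"
proof -
  obtain c where c: "\<exists>k\<in>A. c k \<noteq> 0" "\<forall>i<N. (\<Sum>k\<in>A. c k * coeff (g k) i) = 0"
    using homogeneous_system_nontrivial_solution[OF assms(1,2), of "\<lambda>k. coeff (g k)"] by auto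
  have "coeff (\<Sum>k\<in>A. smult (c k) (g k)) i = 0" for i
  proof (cases "i < N")
    case True thus ?thesis using c by (simp add: coeff_sum)
  next
    case False
    hence "coeff (g k) i = 0" if "k \<in> A" for k
      using assms(3)[OF that] by (intro coeff_eq_0) auto
    thus ?thesis by (simp add: coeff_sum)
  qed
  thus ?thesis using c(1) by (auto simp: poly_eq_iff)
qed

lemma infinite_UNIV_alg_closed: "infinite (UNIV :: 'b::alg_closed_field set)"
proof
  assume fin: "finite (UNIV :: 'b set)"
  define P :: "'b poly" where "P = (\<Prod>a\<in>UNIV. [:-a, 1:])"
  have "degree P = card (UNIV :: 'b set)" unfolding P_def by (subst degree_prod_sum_eq) auto
  hence "degree P > 0" using fin by (simp add: card_gt_0_iff)
  hence "degree (P + 1) > 0" by (subst degree_add_eq_left) auto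
  then obtain x where "poly (P + 1) x = 0" using alg_closed_imp_poly_has_root by blast
  moreover have "poly P x = 0" unfolding P_def poly_prod using fin by (intro prod_zero) auto
  ultimately show False by simp
qed

lemma poly_eqI_alg_closed:
  fixes p r :: "'b::alg_closed_field poly"
  assumes "\<And>x. poly p x = poly r x"
  shows "p = r"
proof (rule ccontr)
  assume "p \<noteq> r"
  hence "finite {x. poly (p - r) x = 0}" by (intro poly_roots_finite) auto
  thus False using assms infinite_UNIV_alg_closed[where 'b='b] by simp
qed

lemma frob_poly_diff_const:
  fixes f :: "'a::{field,finite} alg_closure poly"
  shows "(f - [:a:]) ^ (CARD('a) ^ n) = f ^ (CARD('a) ^ n) - [:a ^ (CARD('a) ^ n):]"
  by (rule poly_eqI_alg_closed) (simp add: poly_power frob_pow_diff)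

definition nonsquare_poly :: "'b::field poly \<Rightarrow> bool" where
  "nonsquare_poly f \<longleftrightarrow> (\<forall>u v k. k \<noteq> 0 \<longrightarrow> u ^ 2 = smult k (f * v ^ 2) \<longrightarrow> v = 0)"

text \<open>For nonzero \<open>v\<close>, the order of vanishing at \<open>b\<close> would be even
  on the left and odd on the right.\<close>

lemma nonsquare_poly_simple_root:
  fixes f :: "'b::field poly"
  assumes "order b f = 1" and f0: "f \<noteq> 0"
  shows "nonsquare_poly f"
  unfolding nonsquare_poly_def
proof (intro allI impI, rule ccontr)
  fix u v :: "'b poly" and k
  assume *: "k \<noteq> 0" "u ^ 2 = smult k (f * v ^ 2)" "v \<noteq> 0"
  have "u ^ 2 \<noteq> 0" using * f0 by simp
  hence u0: "u \<noteq> 0" by auto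
  have "order b (u ^ 2) = order b (f * v ^ 2)" using * by (simp add: order_smult)
  also have "\<dots> = 1 + 2 * order b v" using f0 * assms
    by (simp add: order_mult power2_eq_square)
  also have "order b (u ^ 2) = 2 * order b u" using u0 by (simp add: order_mult power2_eq_square)
  finally show False by presburger
qed

lemma nonsquare_poly_shift:
  fixes f :: "'b::field poly"
  assumes "nonsquare_poly f"
  shows "nonsquare_poly (pcompose f [:c, 1:])"
  unfolding nonsquare_poly_def
proof (intro allI impI)
  fix u v :: "'b poly" and k
  assume *: "k \<noteq> 0" "u ^ 2 = smult k (pcompose f [:c, 1:] * v ^ 2)"
  let ?s = "\<lambda>p. pcompose p [:-c, 1:]"
  have inv: "?s (pcompose f [:c, 1:]) = f"
    by (simp add: pcompose_assoc[symmetric] pcompose_pCons)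
  have "?s u ^ 2 = ?s (u ^ 2)" by (simp add: power2_eq_square pcompose_mult)
  also have "\<dots> = smult k (f * ?s v ^ 2)" unfolding *(2)
    by (simp add: pcompose_smult pcompose_mult power2_eq_square inv)
  finally have "?s v = 0" using assms *(1) unfolding nonsquare_poly_def by blast
  thus "v = 0" by (simp add: pcompose_eq_0_iff)
qed

text \<open>Multiplying by the conjugate \<open>u - f ^ r * v\<close>, where r = (R+1)/2, gives u^2
  - f f^R v^2. Since \<open>f\<close> is congruent to its constant term modulo X,
  \<open>f ^ R\<close> is congruent to the constant \<open>k\<close> = \<open>coeff f 0 ^ R\<close>
  modulo X^R. So X^R divides u^2 - k f v^2, whose degree is below \<open>R\<close>; it vanishes, and
  \<open>f\<close> is not a square.\<close>

lemma stepanov_block_zero: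
  fixes f :: "'a::{field,finite} alg_closure poly"
  assumes R: "R = CARD('a) ^ n" "odd R" and f: "nonsquare_poly f" "coeff f 0 \<noteq> 0"
    and uv: "degree u < I" "degree v < I" "2 * I + degree f \<le> R"
    and dvd: "monom 1 R dvd u + f ^ ((R + 1) div 2) * v"
  shows "u = 0 \<and> v = 0"
proof -
  let ?k = "coeff f 0 ^ R"
  let ?r = "(R + 1) div 2"
  have r: "f ^ ?r * f ^ ?r = f * f ^ R"
  proof -
    have "?r + ?r = Suc R" using R(2) by presburger
    thus ?thesis by (metis power_Suc power_add)
  qed
  have "monom 1 R dvd (u + f ^ ?r * v) * (u - f ^ ?r * v)" using dvd by simp
  also have "(u + f ^ ?r * v) * (u - f ^ ?r * v) = u ^ 2 - (f ^ ?r * f ^ ?r) * v ^ 2"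
    by (simp add: algebra_simps power2_eq_square)
  finally have d1: "monom 1 R dvd u ^ 2 - f * f ^ R * v ^ 2" unfolding r .
  have "[:0, 1:] dvd f - [:coeff f 0:]" by (simp add: dvd_iff_poly_eq_0 poly_0_coeff_0)
  hence "[:0, 1:] ^ R dvd (f - [:coeff f 0:]) ^ R" by (rule dvd_power_same)
  hence "monom 1 R dvd f ^ R - [:?k:]" unfolding R(1) frob_poly_diff_const by (simp add: monom_altdef)
  hence "monom 1 R dvd (f * v ^ 2) * (f ^ R - [:?k:])" by (rule dvd_mult)
  hence d2: "monom 1 R dvd f * f ^ R * v ^ 2 - smult ?k (f * v ^ 2)" by (simp add: algebra_simps)
  have d3: "monom 1 R dvd u ^ 2 - smult ?k (f * v ^ 2)"
    using dvd_add[OF d1 d2] by simp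
  have "degree (u ^ 2) \<le> degree u * 2" by (rule degree_power_le)
  hence du: "degree (u ^ 2) < R" using uv by linarith
  have "degree (smult ?k (f * v ^ 2)) \<le> degree f + degree v * 2"
    by (rule order.trans[OF degree_smult_le] order.trans[OF degree_mult_le] add_left_mono degree_power_le)+
  hence "degree (smult ?k (f * v ^ 2)) < R" using uv by linarith
  hence "degree (u ^ 2 - smult ?k (f * v ^ 2)) < R" using du by (rule degree_diff_less[rotated])
  hence "u ^ 2 - smult ?k (f * v ^ 2) = 0"
    using d3 dvd_imp_degree_le[OF d3] by (auto simp: degree_monom_eq)
  hence eq: "u ^ 2 = smult ?k (f * v ^ 2)" by simp
  have "?k \<noteq> 0" using f by simp
  hence "v = 0" using f(1) eq unfolding nonsquare_poly_def by blast
  thus ?thesis using eq by simp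
qed

text \<open>All blocks but the lowest are divisible by X^R, so the lowest one is zero by the
  preceding lemma; cancel X^R and repeat.\<close>

lemma stepanov_nonvanishing:
  fixes f :: "'a::{field,finite} alg_closure poly"
  assumes R: "R = CARD('a) ^ n" "odd R" and f: "nonsquare_poly f" "coeff f 0 \<noteq> 0"
    and I: "2 * I + degree f \<le> R"
    and uv: "\<And>j. degree (u j) < I" "\<And>j. degree (v j) < I"
    and sum: "(\<Sum>j<J. monom 1 (j * R) * (u j + f ^ ((R + 1) div 2) * v j)) = 0"
  shows "\<forall>j<J. u j = 0 \<and> v j = 0"
  using uv sum
proof (induction J arbitrary: u v)
  case (Suc J)
  let ?r = "(R + 1) div 2"
  let ?T = "\<Sum>j<J. monom 1 (j * R) * (u (Suc j) + f ^ ?r * v (Suc j))"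
  have "(\<Sum>j<Suc J. monom 1 (j * R) * (u j + f ^ ?r * v j)) =
     (u 0 + f ^ ?r * v 0) + (\<Sum>j<J. monom 1 (Suc j * R) * (u (Suc j) + f ^ ?r * v (Suc j)))"
    unfolding sum.lessThan_Suc_shift by (simp add: monom_0 one_pCons[symmetric])
  also have "(\<Sum>j<J. monom 1 (Suc j * R) * (u (Suc j) + f ^ ?r * v (Suc j))) = monom 1 R * ?T"
    by (simp add: sum_distrib_left mult_monom flip: mult.assoc)
  finally have eq: "(u 0 + f ^ ?r * v 0) + monom 1 R * ?T = 0" using Suc.prems by simp
  hence "u 0 + f ^ ?r * v 0 = monom 1 R * (- ?T)" by (simp add: eq_neg_iff_add_eq_0)
  hence "monom 1 R dvd u 0 + f ^ ?r * v 0" by simp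
  hence z: "u 0 = 0 \<and> v 0 = 0" using stepanov_block_zero[OF R f Suc.prems(1,2) I] by blast
  hence "?T = 0" using eq by simp
  hence "\<forall>j<J. u (Suc j) = 0 \<and> v (Suc j) = 0"
    using Suc.IH[of "\<lambda>j. u (Suc j)" "\<lambda>j. v (Suc j)"] Suc.prems(1,2) by blast
  thus ?case using z by (auto simp: less_Suc_eq_0_disj)
qed simp

lemma degree_monom_mult_le: "degree (monom a n * p) \<le> n + degree (p :: 'b::comm_semiring_1 poly)"
  using degree_mult_le[of "monom a n" p] degree_monom_le[of a n] by linarith

text \<open>
  The auxiliary polynomial is \<open>S = \<Sum> \<delta>(i,j,t) Y^(i + j R) f^(t (R+1)/2)\<close> with \<open>Y = X - c\<close>. Its \<open>R\<close>-th
  power agrees on the points in question with \<open>\<Sum> \<delta>(i,j,t)^R g(i,j,t)\<close>, of far smaller degree, which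
  linear algebra can make vanish. Taking the \<open>R\<close>-th root replaces the multiplicities that Stepanov's
  method otherwise obtains from hyperderivatives.
\<close>

lemma stepanov_point_count:
  fixes d :: "'a::{field_gcd,finite} poly" and \<epsilon> :: "'a alg_closure"
  assumes R: "R = CARD('a) ^ n" "odd R" and sf: "nonsquare_poly (map_poly to_ac d)"
    and d0: "d \<noteq> 0" and large: "2 * degree d + 5 \<le> R"
  shows "2 * card {x. x ^ (R * R) = x \<and> ev d x ^ ((R * R - 1) div 2) = \<epsilon>} \<le> R * R + 4 * degree d * R"
proof -
  define D where "D = degree d"
  have "finite {x. poly (map_poly to_ac d) x = 0}" using d0 by (intro poly_roots_finite) simp
  then obtain c where c: "poly (map_poly to_ac d) c \<noteq> 0"
    using infinite_UNIV_alg_closed[where 'b="'a alg_closure"] by (metis (mono_tags, lifting) UNIV_eq_I mem_Collect_eq)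
  \<comment> \<open>Shifting to a point \<open>c\<close> that is not a root of \<open>d\<close>
    gives \<open>f\<close> a nonzero constant term, as the independence of the blocks
    requires.\<close>
  define f where "f = pcompose (map_poly to_ac d) [:c, 1:]"
  have sff: "nonsquare_poly f" unfolding f_def by (rule nonsquare_poly_shift[OF sf])
  have f_ev: "poly f y = ev d (y + c)" for y by (simp add: f_def ev_def poly_pcompose add.commute)
  have f0: "coeff f 0 \<noteq> 0" using c f_ev[of 0] by (simp add: poly_0_coeff_0 ev_def)
  have df: "degree f = D" by (simp add: f_def degree_pcompose D_def)
  \<comment> \<open>The largest \<open>I\<close> with 2 I + D \<le> R, the degree condition for
    independence.\<close>
  define I where "I = (R - D) div 2"
  define r where "r = (R + 1) div 2"
  \<comment> \<open>The \<open>D\<close> added to \<open>r\<close> supplies 2 I D further unknowns,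
    which outweigh the D r that the factor \<open>f ^ r\<close> adds to the degrees.\<close>
  define J where "J = r + D"
  obtain s where s: "R = 2 * s + 1" using R(2) by (metis oddE)
  have r: "r = s + 1" by (simp add: r_def s)
  have I: "2 * I + D \<le> R" "R \<le> 2 * I + D + 1" "I \<ge> 1"
    using large unfolding I_def D_def[symmetric] by linarith+
  define N where "N = (I - 1) * R + J + D * r"
  define A where "A = {..<I} \<times> {..<J} \<times> {0, 1::nat}"
  have cardA: "card A = 2 * I * J" by (simp add: A_def card_cartesian_product)
  have finA: "finite A" by (simp add: A_def)
  have "N < card A"
  proof -
    obtain I' where I': "I = I' + 1" using I(3) by (metis add.commute le_Suc_ex)
    have "s \<le> 2 * I'" using I(2) large s I' unfolding D_def[symmetric] by linarith
    hence Ds: "D * s \<le> D * (2 * I')" by (rule mult_left_mono) simp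
    have "N + I' + s = 2 * (I' * s) + 2 * I' + 2 * s + 1 + 2 * D + D * s"
      unfolding N_def J_def r s I' by (simp add: algebra_simps)
    moreover have "2 * I * J = 2 * (I' * s) + 2 * I' + D * (2 * I') + 2 * s + 2 + 2 * D"
      unfolding J_def r I' by (simp add: algebra_simps)
    ultimately show ?thesis using cardA Ds by linarith
  qed
  let ?Q = "R * R"
  \<comment> \<open>What the \<open>R\<close>-th power of Y^(i + j R) f^(t r) becomes at y = x - c:
    y^(R R) = y + c - c^(R R) is linear in y, and f(y)^(r R) = \<epsilon> f(y)^r because r R = (R R
    - 1)/2 + r. Hence \<open>j\<close> counts once in the degree instead of R R times.\<close>
  define g where "g = (\<lambda>(i, j, t). monom 1 (i * R) * ([:c - c ^ ?Q, 1:] ^ j * smult (\<epsilon> ^ t) (f ^ (t * r))))"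
  have degg: "degree (g k) < N" if kA: "k \<in> A" for k
  proof -
    obtain i j t where k: "k = (i, j, t)" "i < I" "j < J" "t \<in> {0, 1}" using kA unfolding A_def by blast
    have "degree (g k) \<le> i * R + (degree ([:c - c ^ ?Q, 1:] ^ j) + degree (smult (\<epsilon> ^ t) (f ^ (t * r))))"
      unfolding g_def k prod.case
      by (intro order.trans[OF degree_monom_mult_le] add_left_mono degree_mult_le)
    also have "degree ([:c - c ^ ?Q, 1:] ^ j) \<le> 1 * j"
      by (rule order.trans[OF degree_power_le]) simp
    also have "degree (smult (\<epsilon> ^ t) (f ^ (t * r))) \<le> D * (t * r)"
      by (rule order.trans[OF degree_smult_le order.trans[OF degree_power_le]]) (simp add: df)
    also have "D * (t * r) \<le> D * r" using k by auto
    also have "i * R \<le> (I - 1) * R" using k by (intro mult_right_mono) auto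
    finally show ?thesis using k by (simp add: N_def)
  qed
  obtain \<gamma> where \<gamma>: "\<exists>k\<in>A. \<gamma> k \<noteq> 0" "(\<Sum>k\<in>A. smult (\<gamma> k) (g k)) = 0"
    using poly_linear_dependence[where g = g, OF finA \<open>N < card A\<close>] degg by (metis (no_types, lifting))
  have R0: "R > 0" using s by simp
  \<comment> \<open>The roots exist since the closure is algebraically closed, and they make the
    additive map z \<mapsto> z^R turn \<open>S\<close> into the vanishing combination of the
    \<open>g k\<close>.\<close>
  define \<delta> where "\<delta> = (\<lambda>k. SOME z. z ^ R = \<gamma> k)"
  have \<delta>: "\<delta> k ^ R = \<gamma> k" for k
    unfolding \<delta>_def by (rule someI_ex) (rule nth_root_exists[OF R0])
  define S where "S = (\<Sum>(i, j, t)\<in>A. smult (\<delta> (i, j, t)) (monom 1 (i + j * R) * f ^ (t * r)))"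
  define w where "w = (\<lambda>t j. \<Sum>i<I. monom (\<delta> (i, j, t)) i)"
  have S_blocks: "S = (\<Sum>j<J. monom 1 (j * R) * (w 0 j + f ^ r * w 1 j))"
  proof -
    have "S = (\<Sum>i<I. \<Sum>j<J. \<Sum>t\<in>{0, 1}. smult (\<delta> (i, j, t)) (monom 1 (i + j * R) * f ^ (t * r)))"
      unfolding S_def A_def by (simp only: sum.cartesian_product)
    also have "\<dots> = (\<Sum>j<J. \<Sum>i<I. \<Sum>t\<in>{0, 1}. smult (\<delta> (i, j, t)) (monom 1 (i + j * R) * f ^ (t * r)))"
      by (rule sum.swap)
    also have "\<dots> = (\<Sum>j<J. monom 1 (j * R) * (w 0 j + f ^ r * w 1 j))"
    proof (intro sum.cong refl)
      fix j
      have m: "smult a (monom 1 (i + j * R) * h) = monom 1 (j * R) * (monom a i * h)" for a i and h :: "'a alg_closure poly"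
        by (simp add: mult_monom smult_monom add.commute flip: mult.assoc mult_smult_left)
      show "(\<Sum>i<I. \<Sum>t\<in>{0, 1}. smult (\<delta> (i, j, t)) (monom 1 (i + j * R) * f ^ (t * r))) =
         monom 1 (j * R) * (w 0 j + f ^ r * w 1 j)"
        unfolding m w_def by (simp add: sum.distrib sum_distrib_left distrib_left mult_ac)
    qed
    finally show ?thesis .
  qed
  have coeff_w: "coeff (w t j) i = (if i < I then \<delta> (i, j, t) else 0)" for t j i
    by (simp add: w_def coeff_sum coeff_monom sum.delta)
  have deg_w: "degree (w t j) < I" for t j
  proof -
    have "degree (w t j) \<le> I - 1" 
    proof (rule degree_le, intro allI impI)
      fix i assume "i > I - 1"
      hence "\<not> i < I" by linarith
      thus "coeff (w t j) i = 0" by (simp only: coeff_w if_False)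
    qed
    thus ?thesis using I by linarith
  qed
  have "S \<noteq> 0"
  proof
    assume "S = 0"
    hence sum0: "(\<Sum>j<J. monom 1 (j * R) * (w 0 j + f ^ ((R + 1) div 2) * w 1 j)) = 0"
      unfolding S_blocks r_def .
    have "2 * I + degree f \<le> R" using I(1) df by simp
    hence z: "\<forall>j<J. w 0 j = 0 \<and> w 1 j = 0"
      by (rule stepanov_nonvanishing[OF R sff f0 _ deg_w deg_w sum0])
    obtain i j t where k: "i < I" "j < J" "t \<in> {0, 1}" "\<gamma> (i, j, t) \<noteq> 0" using \<gamma>(1) unfolding A_def by blast
    have "\<delta> (i, j, t) = coeff (w t j) i" using k by (simp add: coeff_w)
    also have "\<dots> = 0" using z k by auto
    finally have "\<gamma> (i, j, t) = 0" using \<delta>[of "(i, j, t)"] R0 by (simp add: power_0_left)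
    thus False using k by simp
  qed
  have degS: "degree S \<le> (I - 1) + (J - 1) * R + D * r"
    unfolding S_def
  proof (rule degree_sum_le[OF finA], clarify)
    fix i j t assume "(i, j, t) \<in> A"
    hence k: "i < I" "j < J" "t \<in> {0, 1}" by (auto simp: A_def)
    have "degree (smult (\<delta> (i, j, t)) (monom 1 (i + j * R) * f ^ (t * r))) \<le> (i + j * R) + degree (f ^ (t * r))"
      by (rule order.trans[OF degree_smult_le degree_monom_mult_le])
    also have "degree (f ^ (t * r)) \<le> D * (t * r)" using degree_power_le[of f "t * r"] by (simp add: df)
    also have "D * (t * r) \<le> D * r" using k by auto
    also have "j * R \<le> (J - 1) * R" using k by (intro mult_right_mono) auto
    finally show "degree (smult (\<delta> (i, j, t)) (monom 1 (i + j * R) * f ^ (t * r))) \<le> (I - 1) + (J - 1) * R + D * r"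
      using k by linarith
  qed
  let ?Z = "{x. x ^ ?Q = x \<and> ev d x ^ ((?Q - 1) div 2) = \<epsilon>}"
  have Qn: "?Q = CARD('a) ^ (n + n)" by (simp add: R(1) power_add)
  have vanish: "poly S (x - c) = 0" if "x \<in> ?Z" for x
  proof -
    let ?y = "x - c"
    have yQ: "?y ^ ?Q = ?y + (c - c ^ ?Q)"
      using that unfolding Qn frob_pow_diff by simp
    have rR: "r * R = (?Q - 1) div 2 + r" unfolding r s by (simp add: algebra_simps)
    have fy: "poly f ?y ^ (r * R) = \<epsilon> * poly f ?y ^ r"
      unfolding rR power_add using that by (simp add: f_ev)
    have "poly S ?y ^ R = (\<Sum>(i, j, t)\<in>A. \<delta> (i, j, t) * (?y ^ (i + j * R) * poly f ?y ^ (t * r))) ^ R"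
      by (simp add: S_def poly_sum poly_monom poly_power case_prod_unfold)
    also have "\<dots> = (\<Sum>k\<in>A. (case k of (i, j, t) \<Rightarrow> \<delta> (i, j, t) * (?y ^ (i + j * R) * poly f ?y ^ (t * r))) ^ R)"
      unfolding R(1) by (rule frob_pow_sum)
    also have "\<dots> = (\<Sum>k\<in>A. \<gamma> k * poly (g k) ?y)"
    proof (intro sum.cong refl)
      fix k assume "k \<in> A"
      obtain i j t where k: "k = (i, j, t)" by (cases k) auto
      have e1: "(?y ^ (i + j * R)) ^ R = ?y ^ (i * R) * (?y ^ ?Q) ^ j"
        by (simp add: power_add power_mult_distrib flip: power_mult) (simp add: mult_ac)
      have e2: "(poly f ?y ^ (t * r)) ^ R = \<epsilon> ^ t * poly f ?y ^ (t * r)"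
      proof -
        have "(poly f ?y ^ (t * r)) ^ R = (poly f ?y ^ (r * R)) ^ t"
          by (simp flip: power_mult add: mult_ac)
        also have "\<dots> = \<epsilon> ^ t * (poly f ?y ^ r) ^ t" unfolding fy by (rule power_mult_distrib)
        finally show ?thesis by (simp flip: power_mult add: mult_ac)
      qed
      have "(\<delta> (i, j, t) * (?y ^ (i + j * R) * poly f ?y ^ (t * r))) ^ R =
         \<gamma> (i, j, t) * (?y ^ (i * R) * (?y ^ ?Q) ^ j * (\<epsilon> ^ t * poly f ?y ^ (t * r)))"
        by (simp only: power_mult_distrib e1 e2 \<delta>)
      also have "\<dots> = \<gamma> (i, j, t) * poly (g (i, j, t)) ?y"
        unfolding yQ by (simp add: g_def poly_monom poly_power mult_ac add_ac)
      finally show "(case k of (i, j, t) \<Rightarrow> \<delta> (i, j, t) * (?y ^ (i + j * R) * poly f ?y ^ (t * r))) ^ R = \<gamma> k * poly (g k) ?y"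
        unfolding k by simp
    qed
    also have "\<dots> = poly (\<Sum>k\<in>A. smult (\<gamma> k) (g k)) ?y" by (simp add: poly_sum)
    also have "\<dots> = 0" unfolding \<gamma>(2) by simp
    finally show ?thesis by simp
  qed
  have "card ?Z = card ((\<lambda>x. x - c) ` ?Z)" by (rule card_image[symmetric]) (simp add: inj_on_def)
  also have "\<dots> \<le> card {y. poly S y = 0}"
    using vanish by (intro card_mono poly_roots_finite \<open>S \<noteq> 0\<close>) auto
  also have "\<dots> \<le> (I - 1) + (J - 1) * R + D * r"
    using card_poly_roots_bound[OF \<open>S \<noteq> 0\<close>] degS by linarith
  finally have cz: "card ?Z \<le> (I - 1) + (J - 1) * R + D * r" .
  \<comment> \<open>With R = 2 s + 1 the main term 2 s R is R R - R, and 2 (I - 1) fits into the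
    missing R. So the leading term of the count is exactly half of R R, which makes the upper bounds
    usable in pairs.\<close>
  have "2 * ((I - 1) + (J - 1) * R + D * r) \<le> R * R + 4 * D * R"
  proof -
    have "J - 1 = s + D" by (simp add: J_def r)
    hence "2 * ((I - 1) + (J - 1) * R + D * r) = 2 * (I - 1) + 2 * s * R + 2 * D * R + 2 * D * r"
      by (simp add: algebra_simps)
    moreover have "2 * (I - 1) \<le> R" using I by linarith
    moreover have "2 * s * R + R = R * R" by (simp add: s algebra_simps)
    moreover have "r \<le> R" using r s by simp
    hence "2 * D * r \<le> 2 * D * R" by (intro mult_left_mono) auto
    ultimately show ?thesis by linarith
  qed
  hence "2 * card ?Z \<le> R * R + 4 * D * R" using mult_le_mono2[OF cz, of 2] by (rule order.trans[rotated])
  thus ?thesis unfolding D_def .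
qed

text \<open>A root of a prime factor \<open>P\<close> is a simple root of \<open>d\<close>: it is
  simple in \<open>P\<close> by separability, and the cofactor is not divisible by
  \<open>P\<close>.\<close>

lemma squarefree_imp_nonsquare_poly:
  fixes d :: "'a::{field_gcd,finite} poly"
  assumes d: "squarefree d" "degree d > 0"
  shows "nonsquare_poly (map_poly to_ac d)"
proof -
  have d0: "d \<noteq> 0" using d by auto
  have "\<not> is_unit d" using d is_unit_iff_degree[OF d0] by simp
  then obtain P where P: "prime P" "P dvd d" using prime_divisor_exists[OF d0] by blast
  note pp = prime_poly_props[OF P(1)]
  obtain g where g: "d = P * g" using P by (auto simp: dvd_def)
  have g0: "g \<noteq> 0" using g d0 by auto
  obtain b where b: "ev P b = 0" using ev_root_exists pp by blast
  have "\<not> P dvd g"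
  proof
    assume "P dvd g"
    hence "P ^ 2 dvd d" unfolding g power2_eq_square by (intro mult_dvd_mono) auto
    hence "is_unit P" using d by (simp add: squarefree_def)
    thus False using P by (simp add: prime_def prime_elem_def)
  qed
  hence "ev g b \<noteq> 0" using irreducible_ev_root_dvd[OF pp(1) b] by blast
  hence og: "order b (map_poly to_ac g) = 0" by (intro order_0I) (simp add: ev_def)
  have "count (proots (map_poly to_ac P)) b = 1"
    unfolding proots_irreducible[OF pp(1)] using b finite_ev_roots[OF pp(4)] by simp
  hence oP: "order b (map_poly to_ac P) = 1" using pp(4) by simp
  have "order b (map_poly to_ac d) = 1"
    unfolding g poly_to_ac_mult using oP og g0 pp(4) by (subst order_mult) auto
  thus ?thesis using d0 by (intro nonsquare_poly_simple_root) auto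
qed

section \<open>From point counts to sums over primes\<close>

lemma primes_dividing_finite: "j > 0 \<Longrightarrow> finite (primes_dividing j :: 'a::{field_gcd,finite} poly set)"
  by (auto simp: primes_dividing_def intro!: finite_subset[OF _ finite_primes_degree_le[of j]] dest: dvd_imp_le)

text \<open>A fixed point is a root of X^(q^j) - X, hence of one of its prime factors, and the
  fixed-point criterion for roots gives the degree condition. This sorts the field with q^j elements
  by minimal polynomials.\<close>

lemma fixed_points_eq_UN_roots:
  fixes j :: nat
  assumes "j > 0"
  shows "{x :: 'a::{field_gcd,finite} alg_closure. x ^ (CARD('a) ^ j) = x} =
    (\<Union>p\<in>primes_dividing j. {x. ev p x = 0})"
proof (rule equalityI; rule subsetI)
  fix x :: "'a alg_closure" assume x: "x \<in> {x. x ^ (CARD('a) ^ j) = x}"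
  define f :: "'a poly" where "f = [:0, 1:] ^ (CARD('a) ^ j) - [:0, 1:]"
  have evf: "ev f x = 0" using x by (simp add: f_def ev_diff ev_power)
  have "CARD('a) ^ j > 1" using card_field_gt_1[where 'a='a] assms by (rule one_less_power)
  hence "degree ([:0, 1::'a:]) < degree ([:0, 1::'a:] ^ (CARD('a) ^ j))" by (simp add: degree_power_eq)
  hence f0: "f \<noteq> 0" unfolding f_def by auto
  have "prod_mset (prime_factorization f) = normalize f" using f0 by (rule prod_mset_prime_factorization)
  hence "ev (prod_mset (prime_factorization f)) x = 0"
    using ev_eq_0_mono[OF _ evf, of "normalize f"] by simp
  moreover have "ev (prod_mset A) x = 0 \<Longrightarrow> \<exists>p\<in>#A. ev p x = 0" for A
    by (induction A) (auto simp: ev_mult)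
  ultimately obtain p where p: "p \<in># prime_factorization f" "ev p x = 0" by blast
  hence pr: "prime p" by auto
  have "degree p dvd j" using root_frob_fixed_iff[OF prime_poly_props(1)[OF pr] p(2)] x by blast
  thus "x \<in> (\<Union>p\<in>primes_dividing j. {x. ev p x = 0})" using pr p by (auto simp: primes_dividing_def)
next
  fix x :: "'a alg_closure" assume "x \<in> (\<Union>p\<in>primes_dividing j. {x. ev p x = 0})"
  then obtain p :: "'a poly" where p: "prime p" "degree p dvd j" "ev p x = 0"
    by (auto simp: primes_dividing_def)
  thus "x \<in> {x. x ^ (CARD('a) ^ j) = x}"
    using root_frob_fixed_iff[OF prime_poly_props(1)[OF p(1)] p(3)] by blast
qed

lemma roots_primes_disjoint:
  fixes p r :: "'a::{field_gcd,finite} poly"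
  assumes "prime p" "prime r" "p \<noteq> r"
  shows "{x. ev p x = 0} \<inter> {x. ev r x = 0} = {}"
proof -
  have "coprime p r" using assms by (simp add: primes_coprime)
  thus ?thesis using coprime_no_common_ev_root by blast
qed

text \<open>With Q = q^(degree p) and k = \<open>j div degree p\<close>, the exponent (Q^k - 1)/2 is
  (Q - 1)/2 times 1 + Q + ... + Q^(k-1). This sum of k odd terms has the parity of k, and both are
  positive, so the symbol has the same power for either exponent.\<close>

lemma legendre_power_ev:
  fixes p d :: "'a::{field_gcd,finite} poly"
  assumes odd: "odd CARD('a)" and p: "prime p" "degree p dvd j" and j: "j > 0" and x: "ev p x = 0"
  shows "ev d x ^ ((CARD('a) ^ j - 1) div 2) = of_int (poly_legendre d p ^ (j div degree p))"
proof -
  note pp = prime_poly_props[OF p(1)]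
  let ?q = "CARD('a) ^ degree p" and ?k = "j div degree p"
  have jk: "j = degree p * ?k" using p by simp
  have k: "?k > 0" using jk j by (metis mult_0_right neq0_conv)
  let ?s = "\<Sum>i<?k. ?q ^ i"
  have "(?q - 1) * ?s = ?q ^ ?k - 1" by (rule geometric_sum_nat) simp
  also have "?q ^ ?k = CARD('a) ^ j" using jk by (metis power_mult)
  finally have "((?q - 1) div 2) * 2 * ?s = CARD('a) ^ j - 1" using odd by simp
  hence h: "((?q - 1) div 2) * ?s = (CARD('a) ^ j - 1) div 2" by simp
  have par: "even (\<Sum>i<k. ?q ^ i) \<longleftrightarrow> even k" for k
    by (induction k) (use odd in auto)
  have "?s \<noteq> 0" using k by (auto simp: sum_eq_0_iff)
  hence leg: "poly_legendre d p ^ ?s = poly_legendre d p ^ ?k"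
    using poly_legendre_cases[of d p] par[of ?k] k
    by (auto simp: minus_one_power_iff power_0_left)
  have "ev d x ^ ((CARD('a) ^ j - 1) div 2) = (ev d x ^ ((?q - 1) div 2)) ^ ?s"
    unfolding h[symmetric] by (rule power_mult)
  also have "\<dots> = of_int (poly_legendre d p ^ ?s)"
    using poly_legendre_ev[OF odd pp(1) x, of d] by simp
  finally show ?thesis unfolding leg .
qed

text \<open>The integer-valued \<open>s\<close> is the quadratic character of the value of
  \<open>d\<close> in the field with q^j elements. It is constant on the roots of each prime
  \<open>p\<close>, and there are \<open>degree p\<close> of them.\<close>

lemma prime_power_sum_eq_point_count:
  fixes d :: "'a::{field_gcd,finite} poly"
  assumes odd: "odd CARD('a)" and j: "j > 0"
  shows "prime_power_sum d j =
    int (card {x. x ^ (CARD('a) ^ j) = x \<and> ev d x ^ ((CARD('a) ^ j - 1) div 2) = 1}) -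
    int (card {x. x ^ (CARD('a) ^ j) = x \<and> ev d x ^ ((CARD('a) ^ j - 1) div 2) = -1})"
proof -
  let ?F = "{x :: 'a alg_closure. x ^ (CARD('a) ^ j) = x}" and ?h = "(CARD('a) ^ j - 1) div 2"
  have two: "(2 :: 'a alg_closure) \<noteq> 0" by (rule char_neq_2[OF odd])
  hence ne: "(1 :: 'a alg_closure) \<noteq> -1" by (metis one_add_one eq_neg_iff_add_eq_0)
  have fin: "finite ?F" by (rule fixed_points_frob[OF j])
  define s :: "'a alg_closure \<Rightarrow> int" where
    "s = (\<lambda>x. (if ev d x ^ ?h = 1 then 1 else 0) - (if ev d x ^ ?h = -1 then 1 else 0))"
  have s: "s x = poly_legendre d p ^ (j div degree p)" if "p \<in> primes_dividing j" "ev p x = 0" for p x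
  proof -
    have pr: "prime p" "degree p dvd j" using that by (auto simp: primes_dividing_def)
    define l where "l = poly_legendre d p ^ (j div degree p)"
    have "poly_legendre d p \<in> {-1, 0, 1}" by (rule poly_legendre_cases)
    hence "l \<in> {-1, 0, 1}" unfolding l_def by (cases "even (j div degree p)") (auto simp: power_0_left split: if_splits)
    moreover have "s x = (if of_int l = (1 :: 'a alg_closure) then 1 else 0) - (if of_int l = (-1 :: 'a alg_closure) then 1 else 0)"
      unfolding s_def legendre_power_ev[OF odd pr j that(2)] l_def ..
    ultimately have "s x = l" using ne by auto
    thus ?thesis by (simp add: l_def)
  qed
  have "(\<Sum>x\<in>?F. s x) = int (card {x \<in> ?F. ev d x ^ ?h = 1}) - int (card {x \<in> ?F. ev d x ^ ?h = -1})"
    unfolding s_def using fin by (simp add: sum_subtractf sum.If_cases Int_def)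
  moreover have "(\<Sum>x\<in>?F. s x) = (\<Sum>p\<in>primes_dividing j. \<Sum>x\<in>{x. ev p x = 0}. s x)"
    unfolding fixed_points_eq_UN_roots[OF j]
  proof (rule sum.UNION_disjoint)
    show "\<forall>p\<in>primes_dividing j. finite {x :: 'a alg_closure. ev p x = 0}"
      by (auto simp: primes_dividing_def prime_poly_props intro!: finite_ev_roots)
    show "\<forall>p\<in>primes_dividing j. \<forall>r\<in>primes_dividing j. p \<noteq> r \<longrightarrow>
        {x :: 'a alg_closure. ev p x = 0} \<inter> {x. ev r x = 0} = {}"
      using roots_primes_disjoint unfolding primes_dividing_def by blast
  qed (rule primes_dividing_finite[OF j])
  moreover have "(\<Sum>x\<in>{x :: 'a alg_closure. ev p x = 0}. s x) = int (degree p) * poly_legendre d p ^ (j div degree p)"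
    if "p \<in> primes_dividing j" for p
  proof -
    have pr: "prime p" using that by (simp add: primes_dividing_def)
    show ?thesis using s[OF that] card_irreducible_ev_roots[OF prime_poly_props(1)[OF pr]] by simp
  qed
  ultimately show ?thesis by (simp add: prime_power_sum_def)
qed

text \<open>X^Q - X has only simple roots: at a root \<open>a\<close>, additivity of Frobenius
  factors it as (X - a) ((X - a)^(Q-1) - 1), and the cofactor is -1 at \<open>a\<close>.\<close>

lemma card_fixed_points_frob:
  assumes "j > 0"
  shows "card {x :: 'a::{field,finite} alg_closure. x ^ (CARD('a) ^ j) = x} = CARD('a) ^ j"
proof -
  let ?Q = "CARD('a) ^ j"
  define P :: "'a alg_closure poly" where "P = monom 1 ?Q - [:0, 1:]"
  have q: "?Q > 1" using card_field_gt_1[where 'a='a] assms by (rule one_less_power)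
  have "P = monom 1 ?Q + [:0, -1:]" by (simp add: P_def)
  hence dP: "degree P = ?Q"
    using degree_add_eq_left[of "[:0, -1:]" "monom (1 :: 'a alg_closure) ?Q"] q by (simp add: degree_monom_eq)
  have P0: "P \<noteq> 0" using dP q by auto
  have F: "{x. x ^ ?Q = x} = {x. poly P x = 0}" by (simp add: P_def poly_monom)
  have ord: "order a P = 1" if "poly P a = 0" for a
  proof -
    have a: "a ^ ?Q = a" using that by (simp add: P_def poly_monom)
    define G :: "'a alg_closure poly" where "G = [:-a, 1:] ^ (?Q - 1) - 1"
    have "P = [:-a, 1:] * G"
    proof (rule poly_eqI_alg_closed)
      fix x
      have "(x - a) * (x - a) ^ (?Q - 1) = (x - a) ^ ?Q" using q by (simp flip: power_Suc)
      also have "\<dots> = x ^ ?Q - a" unfolding frob_pow_diff a ..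
      finally have "(x - a) * (x - a) ^ (?Q - 1) = x ^ ?Q - a" .
      thus "poly P x = poly ([:-a, 1:] * G) x"
        unfolding P_def G_def poly_mult poly_diff poly_power poly_monom by (simp add: algebra_simps)
    qed
    moreover have "poly G a \<noteq> 0" using q by (simp add: G_def poly_power power_0_left)
    hence "order a G = 0" by (rule order_0I)
    moreover have "order a [:-a, 1:] = 1"
      using count_proots[of "[:-a, 1:]" a] by simp
    ultimately show ?thesis using P0 by (metis order_mult add.right_neutral)
  qed
  have "proots P = mset_set {x. poly P x = 0}"
  proof (rule multiset_eqI)
    fix a
    show "count (proots P) a = count (mset_set {x. poly P x = 0}) a"
      using P0 ord[of a] poly_roots_finite[OF P0] by (cases "poly P a = 0") (auto simp: order_0I)
  qed
  hence "card {x. poly P x = 0} = degree P" using proots_splits(2)[OF P0] by simp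
  thus ?thesis unfolding F dP .
qed

lemma prime_power_sum_trivial_bound:
  fixes d :: "'a::{field_gcd,finite} poly"
  assumes odd: "odd CARD('a)" and j: "j > 0"
  shows "\<bar>prime_power_sum d j\<bar> \<le> int (CARD('a) ^ j)"
proof -
  have "card {x. x ^ (CARD('a) ^ j) = x \<and> ev d x ^ ((CARD('a) ^ j - 1) div 2) = e} \<le> CARD('a) ^ j" for e
    by (rule order.trans[OF card_mono[OF fixed_points_frob(1)[OF j]] fixed_points_frob(2)[OF j]]) auto
  from this[of 1] this[of "-1"] show ?thesis
    unfolding prime_power_sum_eq_point_count[OF assms] by linarith
qed

text \<open>Write N(1) and N(-1) for the two counts. They add up to at least R R - D, since other
  points are zeros of \<open>d\<close>, and twice each is at most R R + 4 D R. Hence N(1) - N(-1) =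
  2 N(1) - (N(1) + N(-1)) \<le> 4 D R + D \<le> 5 D R, and likewise with the signs
  exchanged.\<close>

lemma prime_power_sum_weil_bound:
  fixes d :: "'a::{field_gcd,finite} poly"
  assumes odd: "odd CARD('a)" and d: "squarefree d" "degree d > 0" and m: "2 * degree d + 5 \<le> CARD('a) ^ m" "m > 0"
  shows "\<bar>prime_power_sum d (2 * m)\<bar> \<le> 5 * int (degree d) * int (CARD('a) ^ m)"
proof -
  let ?R = "CARD('a) ^ m" and ?D = "degree d"
  let ?h = "(?R * ?R - 1) div 2"
  have d0: "d \<noteq> 0" using d by auto
  have Q: "CARD('a) ^ (2 * m) = ?R * ?R" by (simp add: power_add mult_2)
  have j: "2 * m > 0" using m by simp
  let ?F = "{x :: 'a alg_closure. x ^ (?R * ?R) = x}"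
  let ?N = "\<lambda>e. {x :: 'a alg_closure. x ^ (?R * ?R) = x \<and> ev d x ^ ?h = e}"
  have finF: "finite ?F" using fixed_points_frob(1)[OF j, where 'a='a] Q by simp
  have cF: "card ?F = ?R * ?R" using card_fixed_points_frob[OF j, where 'a='a] Q by simp
  have b: "2 * card (?N e) \<le> ?R * ?R + 4 * ?D * ?R" for e
    by (rule stepanov_point_count[OF refl]) (use odd m d0 squarefree_imp_nonsquare_poly[OF d] in auto)
  have R1: "?R > 1" using m by simp
  have h2: "2 * ?h + 1 = ?R * ?R"
  proof -
    have "odd (?R * ?R)" using odd by simp
    thus ?thesis by presburger
  qed
  have "?F \<subseteq> (?N 1 \<union> ?N (-1)) \<union> {x. ev d x = 0}"
  proof
    fix x assume x: "x \<in> ?F"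
    have "ev d x ^ (?R * ?R) = ev d x"
      using x ev_frob[of d x "2 * m"] unfolding Q by simp
    hence "ev d x ^ (2 * ?h + 1) = ev d x" by (simp only: h2)
    moreover have "y * (y ^ k) ^ 2 = y ^ (2 * k + 1)" for y :: "'a alg_closure" and k
      by (simp add: mult.commute flip: power_mult)
    ultimately have "ev d x * (ev d x ^ ?h) ^ 2 = ev d x * 1" by (metis mult_1_right)
    hence "ev d x = 0 \<or> (ev d x ^ ?h) ^ 2 = 1" by (metis mult_left_cancel)
    thus "x \<in> (?N 1 \<union> ?N (-1)) \<union> {x. ev d x = 0}" using x by (auto simp: power2_eq_1_iff)
  qed
  hence "card ?F \<le> card ((?N 1 \<union> ?N (-1)) \<union> {x. ev d x = 0})"
    by (intro card_mono) (use finF finite_ev_roots[OF d0] in auto)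
  also have "\<dots> \<le> card (?N 1) + card (?N (-1)) + card {x. ev d x = 0}"
    by (meson add_mono_thms_linordered_semiring(3) card_Un_le order.trans)
  also have "card {x. ev d x = 0} \<le> ?D" by (rule card_ev_roots[OF d0])
  finally have low: "?R * ?R \<le> card (?N 1) + card (?N (-1)) + ?D" unfolding cF by simp
  have DR: "?D \<le> ?D * ?R" by simp
  have pps: "prime_power_sum d (2 * m) = int (card (?N 1)) - int (card (?N (-1)))"
    using prime_power_sum_eq_point_count[OF odd j, of d] unfolding Q .
  have le1: "card (?N 1) \<le> card (?N (-1)) + 5 * (?D * ?R)" using b[of 1] low DR by linarith
  have le2: "card (?N (-1)) \<le> card (?N 1) + 5 * (?D * ?R)" using b[of "-1"] low DR by linarith
  have "\<bar>int a - int b\<bar> \<le> 5 * int ?D * int ?R"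
    if "a \<le> b + 5 * (?D * ?R)" "b \<le> a + 5 * (?D * ?R)" for a b
  proof -
    have "int a \<le> int b + 5 * (int ?D * int ?R)" "int b \<le> int a + 5 * (int ?D * int ?R)"
      using that[THEN of_nat_mono[where 'a=int]] by simp_all
    thus ?thesis by linarith
  qed
  from this[OF le1 le2] show ?thesis unfolding pps .
qed

section \<open>A majorant for the logarithm\<close>

text \<open>On the unit circle the real part is half the Dirichlet kernel. Keeping only powers of z
  with nonnegative exponent makes the kernel holomorphic in the disc.\<close>

definition half_kernel :: "nat \<Rightarrow> complex \<Rightarrow> complex" where
  "half_kernel k z = 1 / 2 + (\<Sum>j\<in>{1..k}. z ^ j)"

definition fejer :: "nat \<Rightarrow> complex \<Rightarrow> complex" where
  "fejer n z = (\<Sum>k\<le>n. half_kernel k z)"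

text \<open>Induction through |1 + w|^2 = 1 + 2 Re w + |w|^2, where w is z times the previous
  geometric sum.\<close>

lemma fejer_unit_circle:
  assumes "norm z = 1"
  shows "2 * Re (fejer n z) = (norm (\<Sum>j\<le>n. z ^ j)) ^ 2"
proof (induction n)
  case 0
  show ?case by (simp add: fejer_def half_kernel_def)
next
  case (Suc n)
  let ?T = "\<Sum>j\<le>n. z ^ j"
  have T: "(\<Sum>j\<le>Suc n. z ^ j) = 1 + z * ?T"
    by (simp only: sum.atMost_Suc_shift) (simp add: sum_distrib_left)
  have zT: "z * ?T = (\<Sum>j\<in>{1..Suc n}. z ^ j)"
    by (induction n) (simp_all add: distrib_left)
  have "(norm (1 + z * ?T)) ^ 2 = 1 + 2 * Re (z * ?T) + (norm (z * ?T)) ^ 2"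
    unfolding cmod_power2 by (simp add: power2_eq_square algebra_simps)
  also have "(norm (z * ?T)) ^ 2 = 2 * Re (fejer n z)" using Suc assms by (simp add: norm_mult)
  finally show ?case unfolding T zT by (simp add: fejer_def half_kernel_def algebra_simps)
qed

text \<open>The minimum principle for a harmonic function, in the guise of the maximum modulus
  principle for exp(-F), whose modulus is exp(-Re F).\<close>

lemma Re_fejer_nonneg:
  assumes "norm z \<le> 1"
  shows "Re (fejer n z) \<ge> 0"
proof -
  have "norm (exp (- fejer n z)) \<le> 1"
  proof (rule maximum_modulus_frontier[where S = "cball 0 1" and f = "\<lambda>z. exp (- fejer n z)"])
    show "(\<lambda>z. exp (- fejer n z)) holomorphic_on interior (cball 0 1)"
      unfolding fejer_def half_kernel_def by (intro holomorphic_intros)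
    show "continuous_on (closure (cball 0 1)) (\<lambda>z. exp (- fejer n z))"
      unfolding fejer_def half_kernel_def by (intro continuous_intros)
    fix w :: complex assume "w \<in> frontier (cball 0 1)"
    hence "norm w = 1" by (simp add: frontier_cball)
    hence "2 * Re (fejer n w) \<ge> 0" unfolding fejer_unit_circle[OF \<open>norm w = 1\<close>] by simp
    thus "norm (exp (- fejer n w)) \<le> 1" by (simp add: norm_exp_eq_Re)
  qed (use assms in auto)
  thus ?thesis by (simp add: norm_exp_eq_Re)
qed

lemma fejer_coeffs:
  "fejer n z = of_nat (n + 1) / 2 + (\<Sum>j\<in>{1..n}. of_nat (n + 1 - j) * z ^ j)"
proof (induction n)
  case 0
  show ?case by (simp add: fejer_def half_kernel_def)
next
  case (Suc n)
  have "(\<Sum>j\<in>{1..Suc n}. of_nat (Suc n + 1 - j) * z ^ j) =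
      (\<Sum>j\<in>{1..Suc n}. of_nat (n + 1 - j) * z ^ j + z ^ j)"
    by (intro sum.cong refl) (auto simp: Suc_diff_le algebra_simps)
  also have "\<dots> = (\<Sum>j\<in>{1..n}. of_nat (n + 1 - j) * z ^ j) + (\<Sum>j\<in>{1..Suc n}. z ^ j)"
    by (simp add: sum.distrib)
  finally have s: "(\<Sum>j\<in>{1..Suc n}. of_nat (Suc n + 1 - j) * z ^ j) =
      (\<Sum>j\<in>{1..n}. of_nat (n + 1 - j) * z ^ j) + (\<Sum>j\<in>{1..Suc n}. z ^ j)" .
  have e: "of_nat (Suc n + 1) / 2 = of_nat (n + 1) / 2 + (1 / 2 :: complex)"
    by (simp add: add_divide_distrib)
  have "fejer (Suc n) z = fejer n z + half_kernel (Suc n) z" by (simp add: fejer_def)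
  thus ?case unfolding Suc half_kernel_def s e by (simp only: add_ac)
qed

lemma half_reciprocals_le:
  assumes "a > (0::real)"
  shows "1 / (2 * a) + 1 / (2 * (a + 1)) \<le> 1 / a"
proof -
  have "1 / (2 * (a + 1)) \<le> 1 / (2 * a)" using assms by (intro divide_left_mono) auto
  moreover have "1 / (2 * a) + 1 / (2 * a) = 1 / a" by simp
  ultimately show ?thesis by linarith
qed

text \<open>From 1/n the first summation by parts takes 1/N, and the second takes the coefficient of
  z^n in the Fejer sum of index N - 1, divided by N (N + 1). The result equals (N - n)/N (1/n - 1/(N
  + 1)), so it vanishes at n = N.\<close>

definition maj_coeff :: "nat \<Rightarrow> nat \<Rightarrow> real" where
  "maj_coeff N n = (1 / real n - 1 / real N) - (real N - real n) / (real N * (real N + 1))"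

text \<open>
  Twofold summation by parts of \<open>\<Sum> z ^ n / n\<close> starting at \<open>n = N\<close> leaves a combination of Fejer
  sums with positive weights \<open>1 / (n (n + 1)) - 1 / ((n + 1) (n + 2))\<close>; the terms before it form
  this polynomial, which therefore increases with \<open>N\<close> towards \<open>- ln (1 - z)\<close>.
\<close>

definition log_minorant :: "nat \<Rightarrow> complex \<Rightarrow> complex" where
  "log_minorant N z = (\<Sum>n\<in>{1..N}. of_real (maj_coeff N n) * z ^ n)
     - of_real (1 / (2 * real N) + 1 / (2 * (real N + 1)))"

text \<open>The factor is 1/(N (N+1)) - 1/((N+1) (N+2)), a second difference of 1/n; its positivity
  drives the monotonicity. The identity is checked coefficient by coefficient.\<close>

lemma log_minorant_step:
  assumes N: "N \<ge> 1"
  shows "log_minorant (Suc N) z - log_minorant N z =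
    of_real (2 / (real N * (real N + 1) * (real N + 2))) * fejer N z"
proof -
  let ?w = "2 / (real N * (real N + 1) * (real N + 2))"
  have N0: "real N > 0" using N by simp
  have 1: "maj_coeff (Suc N) n - maj_coeff N n = ?w * real (N + 1 - n)" if n: "n \<in> {1..N}" for n
  proof -
    have r: "real (N + 1 - n) = real N + 1 - real n" using n by auto
    have n0: "real n > 0" using n by simp
    have "(1 / b - 1 / (a + 1)) - (a + 1 - b) / ((a + 1) * (a + 1 + 1)) - ((1 / b - 1 / a) - (a - b) / (a * (a + 1)))
       = 2 / (a * (a + 1) * (a + 2)) * (a + 1 - b)" if "a > 0" "b > 0" for a b :: real
    proof -
      have "a + 1 \<noteq> 0" "a + 2 \<noteq> 0" "a \<noteq> 0" "a + 1 + 1 \<noteq> 0" using that by auto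
      thus ?thesis by (simp add: divide_simps) (simp add: algebra_simps)
    qed
    from this[OF N0 n0] show ?thesis unfolding maj_coeff_def r by (simp add: add.commute)
  qed
  have 2: "maj_coeff (Suc N) (Suc N) = 0" by (simp add: maj_coeff_def)
  have 3: "(1 / (2 * real N) + 1 / (2 * (real N + 1))) - (1 / (2 * real (Suc N)) + 1 / (2 * (real (Suc N) + 1)))
     = ?w * (real (N + 1) / 2)"
  proof -
    have "(1 / (2 * a) + 1 / (2 * (a + 1))) - (1 / (2 * (a + 1)) + 1 / (2 * (a + 2))) =
       2 / (a * (a + 1) * (a + 2)) * ((a + 1) / 2)" if "a > 0" for a :: real
    proof -
      have "a + 1 \<noteq> 0" "a + 2 \<noteq> 0" "a \<noteq> 0" using that by auto
      thus ?thesis by (simp add: divide_simps) (simp add: algebra_simps)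
    qed
    from this[OF N0] show ?thesis by (simp add: add.commute)
  qed
  have "log_minorant (Suc N) z - log_minorant N z =
     (\<Sum>n\<in>{1..N}. of_real (maj_coeff (Suc N) n - maj_coeff N n) * z ^ n) +
     of_real ((1 / (2 * real N) + 1 / (2 * (real N + 1))) - (1 / (2 * real (Suc N)) + 1 / (2 * (real (Suc N) + 1))))"
    unfolding log_minorant_def using 2 by (simp add: sum_subtractf left_diff_distrib)
  also have "(\<Sum>n\<in>{1..N}. of_real (maj_coeff (Suc N) n - maj_coeff N n) * z ^ n) =
     (\<Sum>n\<in>{1..N}. of_real (?w * real (N + 1 - n)) * z ^ n)"
    by (intro sum.cong refl) (simp only: 1)
  also have "\<dots> = of_real ?w * (\<Sum>n\<in>{1..N}. of_nat (N + 1 - n) * z ^ n)"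
  proof -
    have "(\<Sum>n\<in>{1..N}. of_real (w * real (N + 1 - n)) * z ^ n) =
        of_real w * (\<Sum>n\<in>{1..N}. of_nat (N + 1 - n) * z ^ n)" for w
      by (simp only: of_real_mult of_real_of_nat_eq mult.assoc sum_distrib_left)
    thus ?thesis .
  qed
  finally have "log_minorant (Suc N) z - log_minorant N z =
     of_real ?w * (\<Sum>n\<in>{1..N}. of_nat (N + 1 - n) * z ^ n) + of_real (?w * (real (N + 1) / 2))"
    unfolding 3 .
  moreover have "of_real (real (N + 1) / 2) = (of_nat (N + 1) / 2 :: complex)" by simp
  moreover have "of_real w * T + of_real (w * v) = of_real w * (of_real v + T)" for w v and T :: complex
    by (simp add: distrib_left)
  ultimately show ?thesis unfolding fejer_coeffs by metis
qed

lemma Re_log_minorant_mono: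
  assumes "N \<ge> 1" "N \<le> M" "norm z \<le> 1"
  shows "Re (log_minorant N z) \<le> Re (log_minorant M z)"
  using assms(2)
proof (induction M rule: dec_induct)
  case (step M)
  have "M \<ge> 1" using assms step by simp
  have Re_mult: "Re (of_real r * v) = r * Re v" for r v by simp
  have "Re (log_minorant (Suc M) z) - Re (log_minorant M z) =
     2 / (real M * (real M + 1) * (real M + 2)) * Re (fejer M z)"
    using arg_cong[OF log_minorant_step[OF \<open>M \<ge> 1\<close>, of z], of Re]
    by (simp only: Re_mult minus_complex.sel)
  moreover have "\<dots> \<ge> 0" using Re_fejer_nonneg[OF assms(3)] by simp
  ultimately show ?case using step by linarith
qed simp

text \<open>Each coefficient differs from 1/n by at most 2/M and the constant is at most 1/M, so
  inside the open disc a geometric series bounds the error.\<close>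

lemma log_minorant_close:
  assumes "M \<ge> 1" "norm z < 1"
  shows "norm (log_minorant M z - (\<Sum>n\<in>{1..M}. z ^ n / of_nat n)) \<le> (2 / (1 - norm z) + 1) / real M"
proof -
  have M0: "real M > 0" using assms by simp
  have "norm (log_minorant M z - (\<Sum>n\<in>{1..M}. z ^ n / of_nat n)) =
    norm ((\<Sum>n\<in>{1..M}. of_real (maj_coeff M n - 1 / real n) * z ^ n)
       - of_real (1 / (2 * real M) + 1 / (2 * (real M + 1))))"
    unfolding log_minorant_def by (simp add: sum_subtractf left_diff_distrib algebra_simps)
  also have "\<dots> \<le> norm (\<Sum>n\<in>{1..M}. of_real (maj_coeff M n - 1 / real n) * z ^ n) +
      norm (of_real (1 / (2 * real M) + 1 / (2 * (real M + 1))) :: complex)"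
    by (rule norm_triangle_ineq4)
  also have "norm (of_real (1 / (2 * real M) + 1 / (2 * (real M + 1))) :: complex) \<le> 1 / real M"
    unfolding norm_of_real using half_reciprocals_le[OF M0] M0 by simp
  also have "norm (\<Sum>n\<in>{1..M}. of_real (maj_coeff M n - 1 / real n) * z ^ n) \<le>
     (\<Sum>n\<in>{1..M}. (2 / real M) * norm z ^ n)"
  proof (rule sum_norm_le)
    fix n assume n: "n \<in> {1..M}"
    have "1 / real M \<ge> 0" "(real M - real n) / (real M * (real M + 1)) \<ge> 0" using n M0 by simp_all
    hence "\<bar>maj_coeff M n - 1 / real n\<bar> = 1 / real M + (real M - real n) / (real M * (real M + 1))"
      unfolding maj_coeff_def by linarith
    also have "(real M - real n) / (real M * (real M + 1)) \<le> (real M + 1) / (real M * (real M + 1))"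
      using M0 by (intro divide_right_mono) auto
    also have "(real M + 1) / (real M * (real M + 1)) = 1 / real M" using M0 by simp
    finally have "\<bar>maj_coeff M n - 1 / real n\<bar> \<le> 2 / real M" by simp
    thus "norm (of_real (maj_coeff M n - 1 / real n) * z ^ n) \<le> (2 / real M) * norm z ^ n"
      unfolding norm_mult norm_of_real norm_power by (intro mult_right_mono) auto
  qed
  also have "(\<Sum>n\<in>{1..M}. (2 / real M) * norm z ^ n) = (2 / real M) * (\<Sum>n\<in>{1..M}. norm z ^ n)"
    by (simp add: sum_distrib_left)
  also have "\<dots> \<le> (2 / real M) * (1 / (1 - norm z))"
  proof (rule mult_left_mono)
    have "(\<Sum>n\<in>{1..M}. norm z ^ n) \<le> (\<Sum>n. norm z ^ n)"
      by (intro sum_le_suminf summable_geometric) (use assms in auto)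
    thus "(\<Sum>n\<in>{1..M}. norm z ^ n) \<le> 1 / (1 - norm z)" using assms by (simp add: suminf_geometric)
  qed simp
  finally show ?thesis by (simp add: add_divide_distrib mult.commute)
qed

text \<open>The real parts increase with the index and converge to that of the logarithm
  series.\<close>

lemma log_minorant_le_open:
  assumes N: "N \<ge> 1" and z: "norm z < 1"
  shows "Re (log_minorant N z) \<le> - ln (norm (1 - z))"
proof -
  have "(\<lambda>n. (-1) ^ Suc n / of_nat n * (- z) ^ n) sums ln (1 + (- z))"
    by (rule Ln_series) (use z in simp)
  moreover have "(-1) ^ Suc n / of_nat n * (- z) ^ n = - (z ^ n / of_nat n)" for n
    by (cases "even n") simp_all
  ultimately have "(\<lambda>n. - (z ^ n / of_nat n)) sums ln (1 - z)"
    by (simp only: add_uminus_conv_diff)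
  hence "(\<lambda>n. z ^ n / of_nat n) sums (- ln (1 - z))" using sums_minus by fastforce
  hence "(\<lambda>M. \<Sum>n<M. z ^ n / of_nat n) \<longlonglongrightarrow> - ln (1 - z)" by (simp add: sums_def)
  hence "(\<lambda>M. \<Sum>n<Suc M. z ^ n / of_nat n) \<longlonglongrightarrow> - ln (1 - z)" by (rule LIMSEQ_Suc)
  moreover have "(\<Sum>n<Suc M. z ^ n / of_nat n) = (\<Sum>n\<in>{1..M}. z ^ n / of_nat n)" for M
    by (rule sum.mono_neutral_right) auto
  ultimately have lim1: "(\<lambda>M. \<Sum>n\<in>{1..M}. z ^ n / of_nat n) \<longlonglongrightarrow> - ln (1 - z)" by simp
  have "(\<lambda>M. log_minorant M z - (\<Sum>n\<in>{1..M}. z ^ n / of_nat n)) \<longlonglongrightarrow> 0"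
  proof (rule Lim_null_comparison)
    show "\<forall>\<^sub>F M in sequentially. norm (log_minorant M z - (\<Sum>n\<in>{1..M}. z ^ n / of_nat n)) \<le> (2 / (1 - norm z) + 1) / real M"
      using eventually_ge_at_top[of 1] by eventually_elim (rule log_minorant_close[OF _ z])
    show "(\<lambda>M. (2 / (1 - norm z) + 1) / real M) \<longlonglongrightarrow> 0" by (rule lim_const_over_n)
  qed
  from tendsto_add[OF this lim1] have "(\<lambda>M. log_minorant M z) \<longlonglongrightarrow> - ln (1 - z)" by simp
  hence "(\<lambda>M. Re (log_minorant M z)) \<longlonglongrightarrow> Re (- ln (1 - z))" by (rule tendsto_Re)
  moreover have "\<forall>\<^sub>F M in sequentially. Re (log_minorant N z) \<le> Re (log_minorant M z)"
    using eventually_ge_at_top[of N] by eventually_elim (use N z in \<open>auto intro!: Re_log_minorant_mono\<close>)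
  ultimately have "Re (log_minorant N z) \<le> Re (- ln (1 - z))"
    by (rule tendsto_lowerbound) simp
  moreover have "1 - z \<noteq> 0" using z by auto
  ultimately show ?thesis by simp
qed

text \<open>The boundary is needed, since |z| = 1 is allowed. Multiplied out, the inequality says
  that (1 - z) exp(P z), with P the minorant, has norm at most 1; this function is continuous even
  at z = 1, where the logarithm is not, so the bound extends to the closed disc.\<close>

lemma norm_one_minus_le:
  assumes N: "N \<ge> 1" and z: "norm z \<le> 1"
  shows "norm (1 - z) \<le> exp (1 / real N - Re (\<Sum>n\<in>{1..N}. of_real (maj_coeff N n) * z ^ n))"
proof -
  have "norm ((1 - z) * exp (log_minorant N z)) \<le> 1"
  proof (rule continuous_on_closure_norm_le[where s = "ball 0 1" and f = "\<lambda>z. (1 - z) * exp (log_minorant N z)"])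
    show "continuous_on (closure (ball 0 1)) (\<lambda>z. (1 - z) * exp (log_minorant N z))"
      unfolding log_minorant_def by (intro continuous_intros)
    show "\<forall>y\<in>ball 0 1. norm ((1 - y) * exp (log_minorant N y)) \<le> 1"
    proof
      fix y :: complex assume "y \<in> ball 0 1"
      hence y: "norm y < 1" by simp
      hence y1: "norm (1 - y) > 0" by auto
      have "exp (Re (log_minorant N y)) \<le> exp (- ln (norm (1 - y)))"
        using log_minorant_le_open[OF N y] by simp
      also have "\<dots> = 1 / norm (1 - y)" using y1 by (simp add: exp_minus field_simps)
      finally have "norm (1 - y) * exp (Re (log_minorant N y)) \<le> norm (1 - y) * (1 / norm (1 - y))"
        by (intro mult_left_mono) auto
      also have "\<dots> = 1" using y1 by simp
      finally show "norm ((1 - y) * exp (log_minorant N y)) \<le> 1"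
        by (simp only: norm_mult norm_exp_eq_Re)
    qed
  qed (use z in auto)
  hence "norm (1 - z) * exp (Re (log_minorant N z)) \<le> 1" by (simp only: norm_mult norm_exp_eq_Re)
  hence "norm (1 - z) \<le> exp (- Re (log_minorant N z))" by (simp add: exp_minus field_simps)
  also have "\<dots> \<le> exp (1 / real N - Re (\<Sum>n\<in>{1..N}. of_real (maj_coeff N n) * z ^ n))"
  proof -
    have "1 / (2 * real N) + 1 / (2 * (real N + 1)) \<le> 1 / real N"
      using N by (intro half_reciprocals_le) simp
    thus ?thesis unfolding log_minorant_def minus_complex.sel Re_complex_of_real by simp
  qed
  finally show ?thesis .
qed

lemma maj_coeff_bounds:
  assumes "1 \<le> n" "n \<le> N"
  shows "0 \<le> maj_coeff N n" "maj_coeff N n \<le> 1 / real n"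
proof -
  have "maj_coeff N n = (real N - real n) / real N * (1 / real n - 1 / (real N + 1))"
  proof -
    have "(1 / b - 1 / a) - (a - b) / (a * (a + 1)) = (a - b) / a * (1 / b - 1 / (a + 1))"
      if "a > 0" "b > 0" for a b :: real
    proof -
      have "a + 1 \<noteq> 0" "a \<noteq> 0" "b \<noteq> 0" using that by auto
      thus ?thesis by (simp add: divide_simps) (simp add: algebra_simps)
    qed
    thus ?thesis using assms unfolding maj_coeff_def by simp
  qed
  moreover have "1 / (real N + 1) \<le> 1 / real n" using assms by (intro divide_left_mono) auto
  ultimately show "0 \<le> maj_coeff N n" using assms by simp
  have "(real N - real n) / (real N * (real N + 1)) \<ge> 0" using assms by simp
  moreover have "1 / real N \<ge> 0" by simp
  ultimately show "maj_coeff N n \<le> 1 / real n" unfolding maj_coeff_def by linarith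
qed

lemma norm_prod_one_minus_le:
  fixes A :: "complex multiset"
  assumes A: "\<And>z. z \<in># A \<Longrightarrow> norm z \<le> 1" and x: "x \<ge> 0"
    and p: "\<And>n. n \<ge> 1 \<Longrightarrow> norm (\<Sum>z\<in>#A. z ^ n) \<le> x ^ n"
  shows "norm (\<Prod>z\<in>#A. 1 - z) \<le> exp (real (size A) / real (Suc M) + (\<Sum>n\<in>{1..M}. x ^ n / real n))"
proof -
  \<comment> \<open>The coefficient at n = N is zero, so with N = M + 1 only the power sums up to
    \<open>M\<close> enter.\<close>
  let ?N = "Suc M"
  have "(\<forall>z\<in>#B. norm z \<le> 1) \<Longrightarrow> norm (\<Prod>z\<in>#B. 1 - z) \<le>
      exp (real (size B) / real ?N - Re (\<Sum>n\<in>{1..?N}. of_real (maj_coeff ?N n) * (\<Sum>z\<in>#B. z ^ n)))" for B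
  proof (induction B)
    case (add z B)
    have "norm (\<Prod>z\<in>#add_mset z B. 1 - z) = norm (1 - z) * norm (\<Prod>z\<in>#B. 1 - z)" by (simp add: norm_mult)
    also have "\<dots> \<le> exp (1 / real ?N - Re (\<Sum>n\<in>{1..?N}. of_real (maj_coeff ?N n) * z ^ n)) *
       exp (real (size B) / real ?N - Re (\<Sum>n\<in>{1..?N}. of_real (maj_coeff ?N n) * (\<Sum>z\<in>#B. z ^ n)))"
      using add by (intro mult_mono norm_one_minus_le) auto
    also have "\<dots> = exp (real (size (add_mset z B)) / real ?N -
        Re (\<Sum>n\<in>{1..?N}. of_real (maj_coeff ?N n) * (\<Sum>z\<in>#add_mset z B. z ^ n)))"
      by (simp add: sum.distrib distrib_left add_divide_distrib diff_divide_distrib flip: exp_add)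
    finally show ?case .
  qed simp
  hence "norm (\<Prod>z\<in>#A. 1 - z) \<le>
      exp (real (size A) / real ?N - Re (\<Sum>n\<in>{1..?N}. of_real (maj_coeff ?N n) * (\<Sum>z\<in>#A. z ^ n)))"
    using A by blast
  also have "\<dots> \<le> exp (real (size A) / real ?N + (\<Sum>n\<in>{1..M}. x ^ n / real n))"
  proof -
    have "- Re (\<Sum>n\<in>{1..?N}. of_real (maj_coeff ?N n) * (\<Sum>z\<in>#A. z ^ n)) \<le>
       norm (\<Sum>n\<in>{1..?N}. of_real (maj_coeff ?N n) * (\<Sum>z\<in>#A. z ^ n))"
      using abs_Re_le_cmod abs_le_iff by blast
    also have "norm (\<Sum>n\<in>{1..?N}. of_real (maj_coeff ?N n) * (\<Sum>z\<in>#A. z ^ n)) =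
        norm (\<Sum>n\<in>{1..M}. of_real (maj_coeff ?N n) * (\<Sum>z\<in>#A. z ^ n))"
      by (simp add: maj_coeff_def[of "Suc M" "Suc M"])
    also have "\<dots> \<le> (\<Sum>n\<in>{1..M}. x ^ n / real n)"
    proof (rule sum_norm_le)
      fix n assume n: "n \<in> {1..M}"
      have "norm (of_real (maj_coeff ?N n) * (\<Sum>z\<in>#A. z ^ n)) = \<bar>maj_coeff ?N n\<bar> * norm (\<Sum>z\<in>#A. z ^ n)"
        by (simp add: norm_mult)
      also have "\<dots> \<le> 1 / real n * x ^ n"
        using n maj_coeff_bounds[of n ?N] p[of n] by (intro mult_mono) auto
      finally show "norm (of_real (maj_coeff ?N n) * (\<Sum>z\<in>#A. z ^ n)) \<le> x ^ n / real n" by simp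
    qed
    finally have "- Re (\<Sum>n\<in>{1..?N}. of_real (maj_coeff ?N n) * (\<Sum>z\<in>#A. z ^ n)) \<le> (\<Sum>n\<in>{1..M}. x ^ n / real n)" .
    thus ?thesis by (subst exp_le_cancel_iff) linarith
  qed
  finally show ?thesis .
qed

text \<open>The induction needs 8 (M+1)/M \<le> 7 x. For M \<ge> 2 the left side is at most 12,
  whence the threshold 12/7, which lies below sqrt 3; the step from M = 1 is checked
  directly.\<close>

lemma sum_power_over_le:
  assumes x: "x \<ge> (12/7 :: real)" and M: "M \<ge> 1"
  shows "(\<Sum>n\<in>{1..M}. x ^ n / real n) \<le> 8 * x ^ M / real M"
  using M
proof (induction M rule: dec_induct)
  case base
  show ?case using x by simp
next
  case (step M)
  show ?case
  proof (cases "M = 1")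
    case True
    have "{1..Suc 1} = {1, 2::nat}" by auto
    moreover have "2 * x \<le> 7 * x * x" using x by (intro mult_right_mono) auto
    ultimately show ?thesis using True by (simp add: power2_eq_square)
  next
    case False
    hence M2: "real M \<ge> 2" using step by linarith
    have "8 * (real M + 1) \<le> 12 * real M" using M2 by simp
    also have "\<dots> \<le> (7 * x) * real M" using x by (intro mult_right_mono) auto
    finally have "8 * (real M + 1) / real M \<le> 7 * x" using M2 by (intro mult_imp_div_pos_le) auto
    hence "8 / real M \<le> 7 * x / (real M + 1)" using M2 by (intro mult_imp_le_div_pos) auto
    hence "8 / real M * x ^ M \<le> 7 * x / (real M + 1) * x ^ M" using x by (intro mult_right_mono) auto
    hence "8 * x ^ M / real M \<le> 7 * x ^ Suc M / real (Suc M)" by (simp add: mult.assoc add.commute)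
    moreover have "(\<Sum>n\<in>{1..Suc M}. x ^ n / real n) = (\<Sum>n\<in>{1..M}. x ^ n / real n) + x ^ Suc M / real (Suc M)"
      using step by simp
    moreover have "8 * x ^ Suc M / real (Suc M) = 7 * x ^ Suc M / real (Suc M) + x ^ Suc M / real (Suc M)"
      by (simp flip: add_divide_distrib)
    ultimately show ?thesis using step.IH by linarith
  qed
qed

section \<open>Inverse roots and the bound on the critical line\<close>

text \<open>Elements of equal modulus might cancel in a power sum. The polynomial \<open>P\<close>
  vanishes at all elements other than \<open>b\<close>, so combining shifted power sums with its
  coefficients isolates a nonzero multiple of b^m, which then grows no faster than \<rho>^m.\<close>

lemma power_sum_growth:
  fixes A :: "complex multiset"
  assumes \<rho>: "\<rho> > 0" and bound: "\<And>m. m \<ge> m0 \<Longrightarrow> norm (\<Sum>z\<in>#A. z ^ m) \<le> C * \<rho> ^ m" and b: "b \<in># A"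
  shows "norm b \<le> \<rho>"
proof (rule ccontr)
  assume "\<not> norm b \<le> \<rho>"
  hence gt: "norm b > \<rho>" by simp
  define P where "P = (\<Prod>x\<in>set_mset A - {b}. [:- x, 1:])"
  have P0: "poly P x = 0" if "x \<in># A" "x \<noteq> b" for x
    unfolding P_def poly_prod using that by (intro prod_zero) auto
  have Pb: "poly P b \<noteq> 0" unfolding P_def poly_prod by auto
  define c where "c = real (count A b) * norm (poly P b)"
  have c: "c > 0" using b Pb by (simp add: c_def)
  have eval: "(\<Sum>k\<le>degree P. coeff P k * (\<Sum>z\<in>#B. z ^ (m + k))) = (\<Sum>z\<in>#B. z ^ m * poly P z)" for B m
  proof (induction B)
    case (add z B)
    have "z ^ m * poly P z = (\<Sum>k\<le>degree P. coeff P k * z ^ (m + k))"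
      by (simp add: poly_altdef sum_distrib_left power_add mult_ac)
    thus ?case using add by (simp add: distrib_left sum.distrib)
  qed simp
  have only_b: "(\<Sum>z\<in>#A. z ^ m * poly P z) = of_nat (count A b) * (b ^ m * poly P b)" for m
  proof -
    have "(\<forall>z\<in>#B. z \<noteq> b \<longrightarrow> f z = 0) \<Longrightarrow> (\<Sum>z\<in>#B. f z) = of_nat (count B b) * f b"
      for B and f :: "complex \<Rightarrow> complex"
      by (induction B) (auto simp: algebra_simps)
    from this[of A "\<lambda>z. z ^ m * poly P z"] show ?thesis using P0 by simp
  qed
  define K where "K = (\<Sum>k\<le>degree P. norm (coeff P k) * C * \<rho> ^ k)"
  have ineq: "c * norm b ^ m \<le> K * \<rho> ^ m" if "m \<ge> m0" for m
  proof -
    have "c * norm b ^ m = norm (\<Sum>k\<le>degree P. coeff P k * (\<Sum>z\<in>#A. z ^ (m + k)))"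
      unfolding eval only_b by (simp add: c_def norm_mult norm_power mult_ac)
    also have "\<dots> \<le> (\<Sum>k\<le>degree P. norm (coeff P k) * (C * \<rho> ^ (m + k)))"
    proof (rule sum_norm_le)
      fix k
      show "norm (coeff P k * (\<Sum>z\<in>#A. z ^ (m + k))) \<le> norm (coeff P k) * (C * \<rho> ^ (m + k))"
        unfolding norm_mult using that by (intro mult_left_mono bound) auto
    qed
    also have "\<dots> = K * \<rho> ^ m" unfolding K_def sum_distrib_right by (intro sum.cong refl) (simp add: power_add)
    finally show ?thesis .
  qed
  have "norm b / \<rho> > 1" using gt \<rho> by simp
  then obtain n where n: "K / c < (norm b / \<rho>) ^ n" using real_arch_pow by blast
  define m where "m = max m0 n"
  have "(norm b / \<rho>) ^ n \<le> (norm b / \<rho>) ^ m" using \<open>norm b / \<rho> > 1\<close> by (intro power_increasing) (auto simp: m_def)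
  also have "\<dots> \<le> K / c" using ineq[of m] c \<rho> by (simp add: m_def power_divide field_simps)
  finally show False using n by linarith
qed

text \<open>The logarithmic derivative of a product of factors 1 - a X, multiplied out so that
  induction over the factors involves no division.\<close>

lemma newton_fps:
  fixes A :: "complex multiset"
  defines "F \<equiv> fps_of_poly (\<Prod>a\<in>#A. [:1, - a:])"
  defines "G \<equiv> Abs_fps (\<lambda>j. if j = 0 then 0 else \<Sum>a\<in>#A. a ^ j)"
  shows "fps_X * fps_deriv F = - (F * G)"
  unfolding F_def G_def
proof (induction A)
  case empty
  show ?case by (simp add: fps_eq_iff)
next
  case (add a A)
  let ?F = "fps_of_poly (\<Prod>a\<in>#A. [:1, - a:])" and ?G = "Abs_fps (\<lambda>j. if j = 0 then 0 else \<Sum>a\<in>#A. a ^ j)"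
  let ?H = "Abs_fps (\<lambda>j. if j = 0 then 0 else a ^ j)"
  let ?l = "1 - fps_const a * fps_X :: complex fps"
  have F: "fps_of_poly (\<Prod>a\<in>#add_mset a A. [:1, - a:]) = ?l * ?F"
  proof -
    have "fps_of_poly [:1, - a:] = ?l"
      by (simp add: fps_of_poly_pCons)
    thus ?thesis by (simp add: fps_of_poly_mult del: mult_pCons_left)
  qed
  have G: "Abs_fps (\<lambda>j. if j = 0 then 0 else \<Sum>a\<in>#add_mset a A. a ^ j) = ?H + ?G"
    by (simp add: fps_eq_iff)
  have H: "?l * ?H = fps_const a * fps_X"
  proof (rule fps_ext)
    fix n
    show "fps_nth (?l * ?H) n = fps_nth (fps_const a * fps_X) n"
      by (cases n) (auto simp: left_diff_distrib mult.assoc split: nat.splits)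
  qed
  have dl: "fps_deriv ?l = - fps_const a" by simp
  have "fps_X * fps_deriv (?l * ?F) = ?l * (fps_X * fps_deriv ?F) - (fps_const a * fps_X) * ?F"
    unfolding fps_deriv_mult dl by (simp add: algebra_simps)
  also have "\<dots> = - (?l * ?F * (?H + ?G))"
  proof -
    have "l * Y - T * F = - (l * F * (H + G))" if "Y = - (F * G)" "l * H = T" for l Y T F H G :: "complex fps"
      unfolding that(1) that(2)[symmetric] by (simp add: algebra_simps)
    from this[OF add.IH H] show ?thesis .
  qed
  finally show ?case unfolding F G .
qed

lemma newton_coeffs:
  fixes A :: "complex multiset"
  defines "P \<equiv> \<Prod>a\<in>#A. [:1, - a:]"
  shows "of_nat n * coeff P n = - (\<Sum>j\<in>{1..n}. (\<Sum>a\<in>#A. a ^ j) * coeff P (n - j))"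
proof -
  let ?G = "Abs_fps (\<lambda>j. if j = 0 then 0 else \<Sum>a\<in>#A. a ^ j)"
  have "fps_nth (fps_X * fps_deriv (fps_of_poly P)) n = of_nat n * coeff P n"
    by (cases n) auto
  moreover have "fps_nth (?G * fps_of_poly P) n = (\<Sum>j\<in>{1..n}. (\<Sum>a\<in>#A. a ^ j) * coeff P (n - j))"
    unfolding fps_mult_nth by (rule sum.mono_neutral_cong_right) auto
  moreover have "fps_nth (fps_X * fps_deriv (fps_of_poly P)) n = - fps_nth (?G * fps_of_poly P) n"
    unfolding P_def newton_fps by (simp add: mult.commute)
  ultimately show ?thesis by simp
qed

lemma poly_factor_unit_constant:
  fixes P :: "complex poly"
  assumes "coeff P 0 = 1"
  obtains A where "P = (\<Prod>a\<in>#A. [:1, - a:])" "size A = degree P"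
proof -
  have P0: "P \<noteq> 0" using assms by auto
  have r0: "x \<noteq> 0" if "x \<in># proots P" for x
    using that assms P0 by (auto simp: poly_0_coeff_0)
  define A where "A = image_mset inverse (proots P)"
  have "0 \<notin># B \<Longrightarrow> (\<Prod>x\<in>#B. [:-x, 1:]) = smult (\<Prod>x\<in>#B. -x) (\<Prod>a\<in>#image_mset inverse B. [:1, - a:])"
    for B :: "complex multiset"
  proof (induction B)
    case (add x B)
    have x: "[:-x, 1:] = smult (-x) [:1, - inverse x:]" using add.prems by simp
    have IH: "(\<Prod>x\<in>#B. [:-x, 1:]) = smult (\<Prod>x\<in>#B. -x) (\<Prod>a\<in>#image_mset inverse B. [:1, - a:])"
      using add by simp
    show ?case
      by (simp only: image_mset_add_mset prod_mset.add_mset x IH mult_smult_left mult_smult_right smult_smult)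
        (simp only: mult.commute)
  qed simp
  hence "(\<Prod>x\<in>#proots P. [:-x, 1:]) = smult (\<Prod>x\<in>#proots P. -x) (\<Prod>a\<in>#A. [:1, - a:])"
    using r0 unfolding A_def by blast
  hence Pc: "P = smult (lead_coeff P * (\<Prod>x\<in>#proots P. -x)) (\<Prod>a\<in>#A. [:1, - a:])"
    using proots_splits(1)[OF P0] by simp
  have "coeff (\<Prod>a\<in>#B. [:1, - a:]) 0 = 1" for B :: "complex multiset"
    by (induction B) (simp_all add: coeff_mult del: mult_pCons_left)
  hence "lead_coeff P * (\<Prod>x\<in>#proots P. -x) = 1"
    using assms arg_cong[OF Pc, of "\<lambda>p. coeff p 0"] by simp
  hence "P = (\<Prod>a\<in>#A. [:1, - a:])" using Pc by simp
  moreover have "size A = degree P" unfolding A_def using proots_splits(2)[OF P0] by simp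
  ultimately show ?thesis using that by blast
qed

text \<open>\<open>M\<close> is the largest integer with q^(M/2) \<le> D. The first term is then at
  most half of D ln q / ln D, as M + 1 > 2 ln D / ln q. The sum is at most 8 D / M \<le> 16 D / (M +
  1), hence at most 8 times that quantity; together 17/2. For M = 0 the sum is empty.\<close>

lemma exponent_bound:
  fixes q D k :: real
  assumes q: "q \<ge> 3" and D: "D \<ge> 3" and k: "0 \<le> k" "k \<le> D"
  defines "M \<equiv> nat \<lfloor>2 * ln D / ln q\<rfloor>"
  shows "k / real (Suc M) + (\<Sum>n\<in>{1..M}. sqrt q ^ n / real n) \<le> 17 / 2 * (D * ln q / ln D)"
proof -
  have l: "ln D > 0" "ln q > 0" using q D by simp_all
  have Mle: "real M \<le> 2 * ln D / ln q" unfolding M_def using l by simp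
  have Mlt: "2 * ln D / ln q < real (Suc M)" unfolding M_def using l by (simp add: of_nat_nat) linarith
  have "1 / real (Suc M) \<le> 1 / (2 * ln D / ln q)"
    using Mlt l by (intro divide_left_mono) auto
  hence inv: "1 / real (Suc M) \<le> ln q / ln D / 2" using l by simp
  have "k / real (Suc M) \<le> D * (1 / real (Suc M))" using k by (simp add: divide_right_mono)
  also have "\<dots> \<le> D * (ln q / ln D / 2)" using inv D by (intro mult_left_mono) auto
  finally have 1: "k / real (Suc M) \<le> D * ln q / ln D / 2" by simp
  have 2: "(\<Sum>n\<in>{1..M}. sqrt q ^ n / real n) \<le> 8 * (D * ln q / ln D)"
  proof (cases "M = 0")
    case True
    thus ?thesis using l D by simp
  next
    case False
    hence M1: "M \<ge> 1" by simp
    have "(12 / 7)\<^sup>2 \<le> q" using q by (simp add: power2_eq_square)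
    hence x: "sqrt q \<ge> 12 / 7" by (rule real_le_rsqrt)
    have "sqrt q ^ M = exp (real M * (ln q / 2))"
      using q by (simp add: exp_of_nat_mult flip: ln_sqrt)
    also have "real M * (ln q / 2) \<le> ln D" using Mle l by (simp add: field_simps)
    hence "exp (real M * (ln q / 2)) \<le> exp (ln D)" by simp
    also have "exp (ln D) = D" using D by simp
    finally have xM: "sqrt q ^ M \<le> D" .
    have "(\<Sum>n\<in>{1..M}. sqrt q ^ n / real n) \<le> 8 * sqrt q ^ M / real M"
      by (rule sum_power_over_le[OF x M1])
    also have "\<dots> \<le> 8 * D / real M" using xM by (intro divide_right_mono) auto
    also have "\<dots> = 8 * D * (1 / real M)" by simp
    also have "1 / real M \<le> 2 * (1 / real (Suc M))" using M1 by (simp add: field_simps)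
    hence "8 * D * (1 / real M) \<le> 8 * D * (2 * (1 / real (Suc M)))" using D by (intro mult_left_mono) auto
    also have "\<dots> \<le> 8 * D * (2 * (ln q / ln D / 2))" using inv D by (intro mult_left_mono) auto
    finally show ?thesis by simp
  qed
  show ?thesis using 1 2 by simp
qed

lemma char_sum_0: "char_sum d 0 = 1"
proof -
  have "monic_of_degree 0 = {1 :: 'a poly}"
    by (auto simp: monic_of_degree_def one_pCons elim!: degree_eq_zeroE)
  thus ?thesis by (simp add: char_sum_def kronecker_poly_def)
qed

text \<open>The power sums of the inverse roots and the negated prime power sums satisfy the same
  Newton recursion with respect to the coefficients of \<open>P\<close>. Its constant term is 1, so
  the recursion determines the \<open>j\<close>-th term from the earlier ones.\<close>

lemma L_inverse_roots:
  fixes d :: "'a::{field_gcd,finite} poly"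
  assumes odd: "odd CARD('a)" and d: "squarefree d" "degree d > 0"
  shows "\<exists>A :: complex multiset. size A \<le> degree d \<and>
    (\<forall>u. (\<Sum>n<degree d. of_int (char_sum d n) * u ^ n) = (\<Prod>a\<in>#A. 1 - a * u)) \<and>
    (\<forall>j\<ge>1. (\<Sum>a\<in>#A. a ^ j) = - of_int (prime_power_sum d j))"
proof -
  define P :: "complex poly" where "P = (\<Sum>n<degree d. monom (of_int (char_sum d n)) n)"
  have cP: "coeff P n = of_int (char_sum d n)" for n
    using char_sum_eq_0[OF odd d, of n] by (simp add: P_def coeff_sum sum.delta)
  have "coeff P 0 = 1" by (simp add: cP char_sum_0)
  then obtain A where A: "P = (\<Prod>a\<in>#A. [:1, - a:])" "size A = degree P"
    by (rule poly_factor_unit_constant)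
  show ?thesis
  proof (intro exI[of _ A] conjI allI impI)
    fix u
    have "(\<Sum>n<degree d. of_int (char_sum d n) * u ^ n) = poly P u"
      by (simp add: P_def poly_sum poly_monom)
    moreover have "poly (\<Prod>a\<in>#B. [:1, - a:]) u = (\<Prod>a\<in>#B. 1 - a * u)" for B
      by (induction B) (simp_all add: algebra_simps)
    ultimately show "(\<Sum>n<degree d. of_int (char_sum d n) * u ^ n) = (\<Prod>a\<in>#A. 1 - a * u)"
      unfolding A(1) by metis
  next
    have "degree P \<le> degree d"
      by (rule degree_le) (auto simp: cP char_sum_eq_0[OF odd d])
    thus "size A \<le> degree d" using A by simp
  next
    fix j :: nat assume "j \<ge> 1"
    thus "(\<Sum>a\<in>#A. a ^ j) = - of_int (prime_power_sum d j)"
    proof (induction j rule: less_induct)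
      case (less n)
      let ?s = "\<lambda>j. (\<Sum>a\<in>#A. a ^ j) + of_int (prime_power_sum d j)"
      have "of_nat n * coeff P n = - (\<Sum>j\<in>{1..n}. (\<Sum>a\<in>#A. a ^ j) * coeff P (n - j))"
        unfolding A(1) by (rule newton_coeffs)
      moreover have "of_nat n * coeff P n = (\<Sum>j\<in>{1..n}. of_int (prime_power_sum d j) * coeff P (n - j))"
        using arg_cong[OF newton_char_sum[of n d], of "of_int :: int \<Rightarrow> complex"] by (simp add: cP)
      ultimately have "(\<Sum>j\<in>{1..n}. ?s j * coeff P (n - j)) = 0"
        by (simp add: distrib_right sum.distrib)
      also have "(\<Sum>j\<in>{1..n}. ?s j * coeff P (n - j)) = (\<Sum>j\<in>{n}. ?s j * coeff P (n - j))"
        by (rule sum.mono_neutral_right) (use less in auto)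
      finally have "?s n = 0" by (simp add: cP char_sum_0)
      thus ?case by (simp add: eq_neg_iff_add_eq_0)
    qed
  qed
qed

text \<open>The Weil-type bound concerns even exponents \<open>2 * m\<close> with \<open>m\<close>
  large. It is therefore read as a bound for the power sums of the squares of the inverse roots,
  with growth rate q.\<close>

lemma L_riemann_hypothesis:
  fixes d :: "'a::{field_gcd,finite} poly"
  assumes odd: "odd CARD('a)" and d: "squarefree d" "degree d > 0"
    and p: "\<And>j. j \<ge> 1 \<Longrightarrow> (\<Sum>a\<in>#A. a ^ j) = - of_int (prime_power_sum d j)"
    and a: "(a :: complex) \<in># A"
  shows "norm a \<le> sqrt (real CARD('a))"
proof -
  have "norm (a ^ 2) \<le> real CARD('a)"
  proof (rule power_sum_growth[where A = "image_mset (\<lambda>z. z ^ 2) A" and C = "5 * real (degree d)"])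
    fix m assume m: "m \<ge> 2 * degree d + 5"
    have "m < CARD('a) ^ m" using card_field_gt_1[where 'a='a]
      by (metis power_gt_expt One_nat_def Suc_le_eq)
    hence m': "2 * degree d + 5 \<le> CARD('a) ^ m" "m > 0" using m by linarith+
    have "(\<Sum>z\<in>#image_mset (\<lambda>z. z ^ 2) A. z ^ m) = (\<Sum>z\<in>#A. z ^ (2 * m))"
      by (simp add: multiset.map_comp o_def power_mult)
    also have "\<dots> = - of_int (prime_power_sum d (2 * m))" using m' by (intro p) simp
    finally have "norm (\<Sum>z\<in>#image_mset (\<lambda>z. z ^ 2) A. z ^ m) = real_of_int \<bar>prime_power_sum d (2 * m)\<bar>" by simp
    also have "\<dots> \<le> real_of_int (5 * int (degree d) * int (CARD('a) ^ m))"
      unfolding of_int_le_iff by (rule prime_power_sum_weil_bound[OF odd d m'])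
    finally show "norm (\<Sum>z\<in>#image_mset (\<lambda>z. z ^ 2) A. z ^ m) \<le> 5 * real (degree d) * real CARD('a) ^ m"
      by simp
  qed (use a in auto)
  thus ?thesis by (intro real_le_rsqrt) (simp add: norm_power)
qed

lemma L_chi_eq_poly:
  fixes d :: "'a::{field_gcd,finite} poly"
  assumes odd: "odd CARD('a)" and d: "squarefree d" "degree d > 0"
  shows "L_chi d s = (\<Sum>n<degree d. of_int (char_sum d n) * exp (- s * of_real (ln (real CARD('a)))) ^ n)"
proof -
  let ?u = "exp (- s * of_real (ln (real CARD('a))))"
  have pw: "complex_of_real (poly_abs m) powr (- s) = ?u ^ n" if "m \<in> monic_of_degree n" for m :: "'a poly" and n
  proof -
    have pos: "real CARD('a) ^ n > 0" by simp
    have "degree m = n" using that by (simp add: monic_of_degree_def)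
    hence "complex_of_real (poly_abs m) powr (- s) = exp (- s * Ln (complex_of_real (real CARD('a) ^ n)))"
      by (simp add: poly_abs_def powr_def)
    also have "Ln (complex_of_real (real CARD('a) ^ n)) = of_real (ln (real CARD('a) ^ n))"
      using pos by (rule Ln_of_real)
    also have "ln (real CARD('a) ^ n) = real n * ln (real CARD('a))" by (simp add: ln_realpow)
    also have "exp (- s * of_real (real n * ln (real CARD('a)))) = ?u ^ n"
      by (simp add: mult_ac flip: exp_of_nat_mult)
    finally show ?thesis .
  qed
  have "(\<Sum>m\<in>monic_of_degree n. of_int (kronecker_poly d m) * complex_of_real (poly_abs m) powr (- s)) =
     of_int (char_sum d n) * ?u ^ n" for n
    by (simp add: pw char_sum_def sum_distrib_right)
  hence "L_chi d s = (\<Sum>n. of_int (char_sum d n) * ?u ^ n)" unfolding L_chi_def by simp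
  also have "\<dots> = (\<Sum>n<degree d. of_int (char_sum d n) * ?u ^ n)"
    by (rule suminf_finite) (auto simp: char_sum_eq_0[OF odd d])
  finally show ?thesis .
qed

theorem theoremA1:
  fixes d :: "'a::{field_gcd,finite} poly" and t :: real
  assumes "odd CARD('a)"
    and "squarefree d"
    and "degree d \<ge> 3"
  shows "cmod (L_chi d (1/2 + \<i> * complex_of_real t))
           < 4 * poly_abs d powr (10 / ln (real (degree d)))"
proof -
  let ?q = "real CARD('a)" and ?D = "real (degree d)"
  have d0: "degree d > 0" using assms by simp
  have q: "?q \<ge> 3" using field_card_odd_gt_2[OF assms(1)] by simp
  define u where "u = exp (- (1/2 + \<i> * complex_of_real t) * of_real (ln ?q))"
  have nu: "norm u = 1 / sqrt ?q"
  proof -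
    have "norm u = exp (- (ln ?q / 2))" by (simp add: u_def norm_exp_eq_Re)
    also have "\<dots> = 1 / sqrt ?q" using q by (simp add: exp_minus inverse_eq_divide flip: ln_sqrt)
    finally show ?thesis .
  qed
  obtain A :: "complex multiset" where A: "\<And>u. (\<Sum>n<degree d. of_int (char_sum d n) * u ^ n) = (\<Prod>a\<in>#A. 1 - a * u)"
    "size A \<le> degree d"
    "\<And>j. j \<ge> 1 \<Longrightarrow> (\<Sum>a\<in>#A. a ^ j) = - of_int (prime_power_sum d j)"
    using L_inverse_roots[OF assms(1,2) d0] by blast
  \<comment> \<open>The inverse roots scaled to the unit disc; on the critical line |u| =
    q^(-1/2).\<close>
  define B where "B = image_mset (\<lambda>a. a * u) A"
  define M where "M = nat \<lfloor>2 * ln ?D / ln ?q\<rfloor>"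
  have "L_chi d (1/2 + \<i> * complex_of_real t) = (\<Prod>z\<in>#B. 1 - z)"
    unfolding L_chi_eq_poly[OF assms(1,2) d0] A(1) u_def[symmetric] B_def
    by (simp add: multiset.map_comp o_def)
  also have "norm \<dots> \<le> exp (real (size B) / real (Suc M) + (\<Sum>n\<in>{1..M}. sqrt ?q ^ n / real n))"
  proof (rule norm_prod_one_minus_le)
    fix z assume "z \<in># B"
    then obtain a where a: "a \<in># A" "z = a * u" by (auto simp: B_def)
    have "norm a \<le> sqrt ?q" by (rule L_riemann_hypothesis[OF assms(1,2) d0 A(3) a(1)])
    thus "norm z \<le> 1" using q by (simp add: a norm_mult nu)
  next
    fix n :: nat assume n: "n \<ge> 1"
    have "(\<Sum>z\<in>#B. z ^ n) = (\<Sum>a\<in>#A. a ^ n) * u ^ n"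
      by (simp add: B_def multiset.map_comp o_def power_mult_distrib sum_mset_distrib_right)
    hence "norm (\<Sum>z\<in>#B. z ^ n) = real_of_int \<bar>prime_power_sum d n\<bar> * (1 / sqrt ?q) ^ n"
      using A(3)[OF n] by (simp add: norm_mult norm_power nu)
    also have "\<dots> \<le> real_of_int (int (CARD('a) ^ n)) * (1 / sqrt ?q) ^ n"
    proof (rule mult_right_mono)
      show "real_of_int \<bar>prime_power_sum d n\<bar> \<le> real_of_int (int (CARD('a) ^ n))"
        unfolding of_int_le_iff using n by (intro prime_power_sum_trivial_bound assms(1)) simp
    qed simp
    also have "\<dots> = (?q * (1 / sqrt ?q)) ^ n"
      by (simp only: power_mult_distrib of_int_of_nat_eq of_nat_power of_int_power)
    also have "?q * (1 / sqrt ?q) = sqrt ?q" using q by (simp add: real_div_sqrt)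
    finally show "norm (\<Sum>z\<in>#B. z ^ n) \<le> sqrt ?q ^ n" .
  qed (use q in auto)
  also have "\<dots> \<le> exp (17 / 2 * (?D * ln ?q / ln ?D))"
    unfolding M_def exp_le_cancel_iff
    using q assms(3) A(2) by (intro exponent_bound) (auto simp: B_def)
  \<comment> \<open>The slack between 17/2 and 10 is given away here, and the factor 4 then makes
    the inequality strict.\<close>
  also have "\<dots> \<le> exp (10 * (?D * ln ?q / ln ?D))"
  proof -
    have "?D * ln ?q / ln ?D \<ge> 0" using q assms(3) by simp
    thus ?thesis unfolding exp_le_cancel_iff by (intro mult_right_mono) auto
  qed
  also have "\<dots> < 4 * exp (10 * (?D * ln ?q / ln ?D))" by simp
  also have "exp (10 * (?D * ln ?q / ln ?D)) = poly_abs d powr (10 / ln ?D)"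
    by (simp add: poly_abs_def powr_def ln_realpow mult_ac)
  finally show ?thesis .
qed

end
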